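(* Let $M$ be a (second countable) smooth manifold. Then the $C^\infty(M)$-module of smooth vector fields on $M$ is finitely generated.
   Context: The $C^\infty(M)$-module of smooth vector fields on $M$ is finitely generated if there is a finite set $\{X_i\}_{i=1}^m$ of smooth vector fields on $M$ (a generating set), $m\in\mathbb{N}_{>0}$, such that every smooth vector field $X$ on $M$ can be written $X=f_1X_1+\cdots+f_mX_m$ with $f_1,\dots,f_m\in C^\infty(M)$. Here $M$ is finite-dimensional and not assumed compact. *)

theory Defs
  imports "HOL-Analysis.Analysis"
begin

text \<open>
  The model space \<^typ>\<open>'e\<close> of an \<open>n\<close>-dimensional manifold is an arbitrary finite-dimensional real inner
  product space, i.e. a copy of \<open>\<real>\<^sup>n\<close>. The class \<open>euclidean_space\<close> is not used because
  it would exclude \<open>n = 0\<close>.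
\<close>

definition finite_dimensional :: "'e::real_vector itself \<Rightarrow> bool" where
  "finite_dimensional _ \<longleftrightarrow> (\<exists>B::'e set. finite B \<and> span B = UNIV)"


section \<open>Smooth maps between open subsets of finite-dimensional spaces\<close>

text \<open>
  \<open>Ck_on k S f\<close> is used for open \<open>S\<close> in a finite-dimensional space only; there, continuity of the
  \<open>k\<close>-th derivative is the same as continuity of all its iterated directional derivatives.
\<close>

fun Ck_on :: "nat \<Rightarrow> 'a::real_normed_vector set \<Rightarrow> ('a \<Rightarrow> 'b::real_normed_vector) \<Rightarrow> bool" where
  "Ck_on 0 S f \<longleftrightarrow> continuous_on S f"
| "Ck_on (Suc k) S f \<longleftrightarrow>
     (\<forall>x\<in>S. f differentiable (at x)) \<and>
     (\<forall>v. Ck_on k S (\<lambda>x. frechet_derivative f (at x) v))"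

definition smooth_on :: "'a::real_normed_vector set \<Rightarrow> ('a \<Rightarrow> 'b::real_normed_vector) \<Rightarrow> bool" where
  "smooth_on S f \<longleftrightarrow> (\<forall>k. Ck_on k S f)"


section \<open>Smooth manifolds\<close>

text \<open>
  A chart is a pair \<open>(U, \<phi>)\<close>. The coordinate map \<open>\<phi>\<close> is a total function whose values outside \<open>U\<close>
  carry no information, so its inverse is taken relative to \<open>U\<close>.
\<close>

type_synonym ('a, 'e) chart = "'a set \<times> ('a \<Rightarrow> 'e)"

definition chart_dom :: "('a, 'e) chart \<Rightarrow> 'a set" where
  "chart_dom c = fst c"

definition chart_map :: "('a, 'e) chart \<Rightarrow> 'a \<Rightarrow> 'e" where
  "chart_map c = snd c"

definition chart_img :: "('a, 'e) chart \<Rightarrow> 'e set" where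
  "chart_img c = chart_map c ` chart_dom c"

definition chart_inv :: "('a, 'e) chart \<Rightarrow> 'e \<Rightarrow> 'a" where
  "chart_inv c = inv_into (chart_dom c) (chart_map c)"

definition is_chart :: "'a topology \<Rightarrow> ('a, 'e::real_inner) chart \<Rightarrow> bool" where
  "is_chart M c \<longleftrightarrow>
     openin M (chart_dom c) \<and> open (chart_img c) \<and>
     homeomorphic_map (subtopology M (chart_dom c)) (top_of_set (chart_img c)) (chart_map c)"

definition transition :: "('a, 'e) chart \<Rightarrow> ('a, 'e) chart \<Rightarrow> 'e \<Rightarrow> 'e" where
  "transition c d = chart_map d \<circ> chart_inv c"

definition smoothly_compatible :: "('a, 'e::real_inner) chart \<Rightarrow> ('a, 'e) chart \<Rightarrow> bool" where
  "smoothly_compatible c d \<longleftrightarrow>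
     smooth_on (chart_map c ` (chart_dom c \<inter> chart_dom d)) (transition c d) \<and>
     smooth_on (chart_map d ` (chart_dom c \<inter> chart_dom d)) (transition d c)"

definition smooth_atlas :: "'a topology \<Rightarrow> ('a, 'e::real_inner) chart set \<Rightarrow> bool" where
  "smooth_atlas M \<A> \<longleftrightarrow>
     (\<forall>c\<in>\<A>. is_chart M c) \<and>
     (\<Union>c\<in>\<A>. chart_dom c) = topspace M \<and>
     (\<forall>c\<in>\<A>. \<forall>d\<in>\<A>. smoothly_compatible c d)"

definition smooth_structure :: "'a topology \<Rightarrow> ('a, 'e::real_inner) chart set \<Rightarrow> bool" where
  "smooth_structure M \<A> \<longleftrightarrow>
     smooth_atlas M \<A> \<and>
     (\<forall>c. is_chart M c \<and> (\<forall>d\<in>\<A>. smoothly_compatible c d) \<longrightarrow> c \<in> \<A>)"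

text \<open>Second countability is kept as a separate hypothesis.\<close>

definition smooth_manifold :: "'a topology \<Rightarrow> ('a, 'e::real_inner) chart set \<Rightarrow> bool" where
  "smooth_manifold M \<A> \<longleftrightarrow>
     finite_dimensional TYPE('e) \<and> Hausdorff_space M \<and> smooth_structure M \<A>"

text \<open>Membership in \<open>C\<^sup>\<infinity>(M)\<close>; values of \<open>f\<close> outside \<open>topspace M\<close> are irrelevant.\<close>

definition smooth_function :: "('a, 'e::real_inner) chart set \<Rightarrow> ('a \<Rightarrow> real) \<Rightarrow> bool" where
  "smooth_function \<A> f \<longleftrightarrow> (\<forall>c\<in>\<A>. smooth_on (chart_img c) (f \<circ> chart_inv c))"


section \<open>Tangent vectors and vector fields\<close>

text \<open>
  A tangent vector at \<open>p\<close> is given by its coordinates in every chart around \<open>p\<close>, where the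
  coordinates in different charts are related by the derivative of the transition map. In charts
  that do not contain \<open>p\<close> the value is normalised to \<open>0\<close>, so that equal tangent vectors are equal
  functions and the vector space operations on each tangent space are the pointwise ones.
\<close>

type_synonym ('a, 'e) tangent_vector = "('a, 'e) chart \<Rightarrow> 'e"

definition tangent_space ::
    "('a, 'e::real_inner) chart set \<Rightarrow> 'a \<Rightarrow> ('a, 'e) tangent_vector set" where
  "tangent_space \<A> p =
     {v. (\<forall>c. c \<notin> \<A> \<or> p \<notin> chart_dom c \<longrightarrow> v c = 0) \<and>
         (\<forall>c\<in>\<A>. \<forall>d\<in>\<A>. p \<in> chart_dom c \<inter> chart_dom d \<longrightarrow>
            v d = frechet_derivative (transition c d) (at (chart_map c p)) (v c))}"

text \<open>
  A smooth vector field is a smooth section of the tangent bundle. A chart \<open>c\<close> of \<open>M\<close> induces the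
  bundle chart sending \<open>(p, v)\<close> to \<open>(chart_map c p, v c)\<close>, and in these charts a section \<open>X\<close> reads
  \<open>x \<mapsto> (x, X (chart_inv c x) c)\<close>.
\<close>

definition smooth_vector_field ::
    "'a topology \<Rightarrow> ('a, 'e::real_inner) chart set \<Rightarrow> ('a \<Rightarrow> ('a, 'e) tangent_vector) \<Rightarrow> bool" where
  "smooth_vector_field M \<A> X \<longleftrightarrow>
     (\<forall>p\<in>topspace M. X p \<in> tangent_space \<A> p) \<and>
     (\<forall>c\<in>\<A>. smooth_on (chart_img c) (\<lambda>x. X (chart_inv c x) c))"

definition vector_fields_finitely_generated ::
    "'a topology \<Rightarrow> ('a, 'e::real_inner) chart set \<Rightarrow> bool" where
  "vector_fields_finitely_generated M \<A> \<longleftrightarrow>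
     (\<exists>(m::nat) (X :: nat \<Rightarrow> 'a \<Rightarrow> ('a, 'e) tangent_vector).
        m > 0 \<and> (\<forall>i\<in>{1..m}. smooth_vector_field M \<A> (X i)) \<and>
        (\<forall>Y. smooth_vector_field M \<A> Y \<longrightarrow>
           (\<exists>f :: nat \<Rightarrow> 'a \<Rightarrow> real.
              (\<forall>i\<in>{1..m}. smooth_function \<A> (f i)) \<and>
              (\<forall>p\<in>topspace M. Y p = (\<lambda>c. \<Sum>i=1..m. f i p *\<^sub>R X i p c)))))"

end

theory Submission
  imports Defs "HOL-Computational_Algebra.Polynomial"
begin

text \<open>
  It suffices to find smooth functions \<open>\<psi> i\<close>, each supported in a chart, locally finite and without a common
  zero, that can be coloured with finitely many colours so that two different functions of the same colour
  have product \<open>0\<close>: for a colour \<open>t\<close> and a basis vector \<open>b\<close>, the sum of the coordinate fields \<open>\<psi> i \<partial>\<^sub>b\<close> over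
  all \<open>i\<close> of colour \<open>t\<close> is a smooth vector field, and these fields generate.

  On a compact set, take finitely many smooth functions that determine the topology near it and have injective
  joint differential, and let \<open>\<psi> i\<close> be bumps of a small common radius for the sup-distance \<open>d\<close> that they define,
  centred at a maximal separated set. Around every point, \<open>dim M\<close> of the functions control all the others up
  to a factor that depends on \<open>dim M\<close> only. Hence the number of bumps meeting a given one is bounded by a
  packing count in dimension \<open>dim M\<close>, however many functions were needed to define \<open>d\<close>, and a greedy
  colouring uses a number of colours that is independent of the compact set. An exhaustion by compact sets
  then gives the global family with three times as many colours.
\<close>

section \<open>Calculus of iterated derivatives\<close>

text \<open>The obstacle is non-compactness. The numbers of charts, auxiliary functions and bumps on
  a compact piece grow without control along an exhaustion, while the generators must be finitely
  many for all pieces together; only a bound in terms of the dimension survives.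

  Colours are needed because of mixed terms. Put \<sigma> = \<Sum> \<psi> i ^ 2 and give the field
  of colour t and direction b the coefficient (\<Sum> \<psi> i * Y_b) / \<sigma>, summed over the i
  of colour t, where Y_b is the coordinate of Y along b in the chart of \<psi> i. Multiplying
  coefficient and field yields all pairs i, j of the same colour, and a pair i \<noteq> j would
  combine coordinates from one chart with coordinate fields of another. Such pairs vanish because
  their product \<psi> i * \<psi> j is 0; the diagonal terms add up to (\<Sum> \<psi> i ^ 2 /
  \<sigma>) Y = Y.\<close>

lemma frechet_derivative_cong_open:
  assumes "open S" "x \<in> S" "\<And>y. y \<in> S \<Longrightarrow> f y = g y"
  shows "frechet_derivative f (at x) = frechet_derivative g (at x)"
proof -
  \<comment> \<open>No differentiability is assumed: \<open>frechet_derivative\<close> is a choice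
    among the derivatives, so having the same derivatives is enough.\<close>
  have "(f has_derivative D) (at x) \<longleftrightarrow> (g has_derivative D) (at x)" for D
    using assms has_derivative_transform_within_open[of f D x UNIV S g]
      has_derivative_transform_within_open[of g D x UNIV S f] by auto
  then show ?thesis
    by (simp add: frechet_derivative_def)
qed

lemma Ck_on_cong:
  assumes "open S" "\<And>x. x \<in> S \<Longrightarrow> f x = g x"
  shows "Ck_on k S f \<longleftrightarrow> Ck_on k S g"
  using assms(2)
proof (induction k arbitrary: f g)
  case 0
  then show ?case
    by (simp cong: continuous_on_cong)
next
  case (Suc k)
  have "f differentiable (at x) \<longleftrightarrow> g differentiable (at x)" if "x \<in> S" for x
    using has_derivative_transform_within_open[of f _ x UNIV S g]
      has_derivative_transform_within_open[of g _ x UNIV S f] that assms(1) Suc.prems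
    by (auto simp: differentiable_def)
  moreover have "Ck_on k S (\<lambda>x. frechet_derivative f (at x) v) \<longleftrightarrow>
      Ck_on k S (\<lambda>x. frechet_derivative g (at x) v)" for v
    by (rule Suc.IH) (simp add: frechet_derivative_cong_open[OF assms(1) _ Suc.prems])
  ultimately show ?case
    by simp
qed

lemma Ck_on_subset:
  assumes "Ck_on k S f" "T \<subseteq> S"
  shows "Ck_on k T f"
  using assms
  by (induction k arbitrary: f) (auto intro: continuous_on_subset)

lemma Ck_on_local:
  assumes "\<And>x. x \<in> S \<Longrightarrow> \<exists>T. open T \<and> x \<in> T \<and> Ck_on k T f"
  shows "Ck_on k S f"
  using assms
proof (induction k arbitrary: f)
  case 0
  have "isCont f x" if "x \<in> S" for x
    using 0[OF that] by (auto simp: continuous_on_eq_continuous_at)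
  then show ?case
    by (simp add: continuous_at_imp_continuous_on)
next
  case (Suc k)
  have "f differentiable (at x)" if "x \<in> S" for x
    using Suc.prems[OF that] by auto
  moreover have "Ck_on k S (\<lambda>x. frechet_derivative f (at x) v)" for v
    by (rule Suc.IH) (use Suc.prems in \<open>auto simp del: all_simps\<close>, meson)
  ultimately show ?case
    by simp
qed

text \<open>Lets an induction on the order work with an explicit formula \<open>D\<close> for the
  derivative instead of the chosen \<open>frechet_derivative\<close>.\<close>

lemma Ck_on_SucI:
  assumes "open S" "\<And>x. x \<in> S \<Longrightarrow> (f has_derivative D x) (at x)"
    and "\<And>v. Ck_on k S (\<lambda>x. D x v)"
  shows "Ck_on (Suc k) S f"
proof -
  have "Ck_on k S (\<lambda>x. frechet_derivative f (at x) v)" for v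
    using assms(3) by (subst Ck_on_cong[OF assms(1)]) (simp_all add: frechet_derivative_at[OF assms(2), symmetric])
  then show ?thesis
    using assms(2) by (auto simp: differentiable_def)
qed

lemma Ck_on_Suc_has_derivative:
  "Ck_on (Suc k) S f \<Longrightarrow> x \<in> S \<Longrightarrow> (f has_derivative frechet_derivative f (at x)) (at x)"
  by (simp add: frechet_derivative_works[symmetric])

text \<open>The recursion passes to derivatives, so lowering the order takes an induction. Product
  and chain rule need it: an undifferentiated factor reappears there and must meet the induction
  hypothesis at the lower order.\<close>

lemma Ck_on_SucD: "Ck_on (Suc k) S f \<Longrightarrow> Ck_on k S f"
proof (induction k arbitrary: f)
  case 0
  then show ?case
    by (auto intro!: continuous_at_imp_continuous_on differentiable_imp_continuous_within)
next
  case (Suc k)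
  then show ?case
    by auto
qed

lemma Ck_on_const: "open S \<Longrightarrow> Ck_on k S (\<lambda>x. c)"
proof (induction k arbitrary: c)
  case (Suc k)
  then show ?case
    by (intro Ck_on_SucI[where D = "\<lambda>x v. 0"]) (auto intro: derivative_eq_intros)
qed auto

lemma Ck_on_bounded_linear: "open S \<Longrightarrow> bounded_linear L \<Longrightarrow> Ck_on k S L"
proof (cases k)
  case (Suc j)
  assume "open S" "bounded_linear L"
  then show ?thesis
    unfolding Suc
    by (intro Ck_on_SucI[where D = "\<lambda>x. L"]) (auto intro: bounded_linear_imp_has_derivative Ck_on_const)
qed (auto intro: linear_continuous_on)

lemma Ck_on_compose_bounded_linear:
  "open S \<Longrightarrow> bounded_linear L \<Longrightarrow> Ck_on k S f \<Longrightarrow> Ck_on k S (\<lambda>x. L (f x))"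
proof (induction k arbitrary: f)
  case 0
  then show ?case
    using continuous_on_compose2[OF linear_continuous_on[of L UNIV]] by auto
next
  case (Suc k)
  show ?case
  proof (rule Ck_on_SucI[where D = "\<lambda>x v. L (frechet_derivative f (at x) v)"])
    show "((\<lambda>x. L (f x)) has_derivative (\<lambda>v. L (frechet_derivative f (at x) v))) (at x)"
      if "x \<in> S" for x
      using bounded_linear.has_derivative[OF Suc.prems(2) Ck_on_Suc_has_derivative[OF Suc.prems(3) that]] .
  qed (use Suc in auto)
qed

lemma Ck_on_add:
  "open S \<Longrightarrow> Ck_on k S f \<Longrightarrow> Ck_on k S g \<Longrightarrow> Ck_on k S (\<lambda>x. f x + g x)"
proof (induction k arbitrary: f g)
  case 0
  then show ?case
    by (auto intro: continuous_on_add)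
next
  case (Suc k)
  show ?case
  proof (rule Ck_on_SucI[where D = "\<lambda>x v. frechet_derivative f (at x) v + frechet_derivative g (at x) v"])
    show "((\<lambda>x. f x + g x) has_derivative
        (\<lambda>v. frechet_derivative f (at x) v + frechet_derivative g (at x) v)) (at x)"
      if "x \<in> S" for x
      by (intro has_derivative_add Ck_on_Suc_has_derivative[OF Suc.prems(2) that]
          Ck_on_Suc_has_derivative[OF Suc.prems(3) that])
  qed (use Suc in auto)
qed

lemma Ck_on_scaleR:
  "open S \<Longrightarrow> Ck_on k S a \<Longrightarrow> Ck_on k S g \<Longrightarrow> Ck_on k S (\<lambda>x. a x *\<^sub>R g x)"
proof (induction k arbitrary: a g)
  case 0
  then show ?case
    by (auto intro: continuous_on_scaleR)
next
  case (Suc k)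
  show ?case
  proof (rule Ck_on_SucI[where D = "\<lambda>x v. a x *\<^sub>R frechet_derivative g (at x) v + frechet_derivative a (at x) v *\<^sub>R g x"])
    show "((\<lambda>x. a x *\<^sub>R g x) has_derivative
        (\<lambda>v. a x *\<^sub>R frechet_derivative g (at x) v + frechet_derivative a (at x) v *\<^sub>R g x)) (at x)"
      if "x \<in> S" for x
      by (intro has_derivative_scaleR Ck_on_Suc_has_derivative[OF Suc.prems(2) that]
          Ck_on_Suc_has_derivative[OF Suc.prems(3) that])
    show "Ck_on k S (\<lambda>x. a x *\<^sub>R frechet_derivative g (at x) v + frechet_derivative a (at x) v *\<^sub>R g x)" for v
      using Suc.prems Ck_on_SucD[OF Suc.prems(2)] Ck_on_SucD[OF Suc.prems(3)]
      by (intro Ck_on_add Suc.IH) auto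
  qed (use Suc in auto)
qed

lemma Ck_on_sum:
  "open S \<Longrightarrow> (\<And>i. i \<in> I \<Longrightarrow> Ck_on k S (f i)) \<Longrightarrow> Ck_on k S (\<lambda>x. \<Sum>i\<in>I. f i x)"
  by (induction I rule: infinite_finite_induct) (auto intro: Ck_on_const Ck_on_add)

text \<open>
  A frame stands in for an orthonormal basis; it may contain \<open>0\<close>, so that it can be chosen nonempty even in
  dimension \<open>0\<close>.
\<close>

definition is_frame :: "'e::real_inner set \<Rightarrow> bool" where
  "is_frame B \<longleftrightarrow> finite B \<and> (\<forall>v. (\<Sum>b\<in>B. (v \<bullet> b) *\<^sub>R b) = v)"

lemma linear_frame:
  assumes "is_frame B" "linear L"
  shows "L v = (\<Sum>b\<in>B. (v \<bullet> b) *\<^sub>R L b)"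
proof -
  have "L v = L (\<Sum>b\<in>B. (v \<bullet> b) *\<^sub>R b)"
    using assms by (simp add: is_frame_def)
  also have "\<dots> = (\<Sum>b\<in>B. (v \<bullet> b) *\<^sub>R L b)"
    by (simp add: linear_sum[OF assms(2)] linear_scale[OF assms(2)])
  finally show ?thesis .
qed

text \<open>The chain rule differentiates f in the direction \<open>?g x v\<close>, which moves with
  x, whereas \<open>Ck_on\<close> speaks of fixed directions only. Expanding the direction in the
  frame leaves fixed directions with variable scalar coefficients.\<close>

lemma Ck_on_compose:
  fixes B :: "'e::real_inner set" and g :: "'a::real_normed_vector \<Rightarrow> 'e"
  assumes B: "is_frame B"
  shows "open S \<Longrightarrow> open T \<Longrightarrow> Ck_on k S g \<Longrightarrow> g ` S \<subseteq> T \<Longrightarrow> Ck_on k T f \<Longrightarrow> Ck_on k S (\<lambda>x. f (g x))"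
proof (induction k arbitrary: f)
  case 0
  then show ?case
    by (auto intro: continuous_on_compose2)
next
  case (Suc k)
  let ?f = "\<lambda>x. frechet_derivative f (at x)" and ?g = "\<lambda>x. frechet_derivative g (at x)"
  show ?case
  proof (rule Ck_on_SucI[where D = "\<lambda>x v. ?f (g x) (?g x v)"])
    show "((\<lambda>x. f (g x)) has_derivative (\<lambda>v. ?f (g x) (?g x v))) (at x)" if "x \<in> S" for x
      using has_derivative_compose[OF Ck_on_Suc_has_derivative[OF Suc.prems(3) that]
          Ck_on_Suc_has_derivative[OF Suc.prems(5)]] Suc.prems(4) that by auto
    have eq: "?f (g x) (?g x v) = (\<Sum>b\<in>B. (?g x v \<bullet> b) *\<^sub>R ?f (g x) b)" if "x \<in> S" for x v
      using linear_frame[OF B] has_derivative_linear[OF Ck_on_Suc_has_derivative[OF Suc.prems(5)]]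
        Suc.prems(4) that by blast
    have "Ck_on k S (\<lambda>x. \<Sum>b\<in>B. (?g x v \<bullet> b) *\<^sub>R ?f (g x) b)" for v
    proof (intro Ck_on_sum Ck_on_scaleR)
      show "Ck_on k S (\<lambda>x. ?g x v \<bullet> b)" for b
        using Suc.prems by (intro Ck_on_compose_bounded_linear[OF _ bounded_linear_inner_left]) auto
      show "Ck_on k S (\<lambda>x. ?f (g x) b)" for b
        using Suc.prems Ck_on_SucD[OF Suc.prems(3)]
        by (intro Suc.IH) auto
    qed (use Suc.prems in auto)
    then show "Ck_on k S (\<lambda>x. ?f (g x) (?g x v))" for v
      by (subst Ck_on_cong[OF Suc.prems(1) eq])
  qed (use Suc in auto)
qed

section \<open>Closure properties of smooth maps\<close>

lemma smooth_on_cong: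
  "open S \<Longrightarrow> (\<And>x. x \<in> S \<Longrightarrow> f x = g x) \<Longrightarrow> smooth_on S f \<longleftrightarrow> smooth_on S g"
  by (simp add: smooth_on_def Ck_on_cong[of S f g])

lemma smooth_on_subset: "smooth_on S f \<Longrightarrow> T \<subseteq> S \<Longrightarrow> smooth_on T f"
  by (auto simp: smooth_on_def intro: Ck_on_subset)

lemma smooth_on_local:
  "(\<And>x. x \<in> S \<Longrightarrow> \<exists>T. open T \<and> x \<in> T \<and> smooth_on T f) \<Longrightarrow> smooth_on S f"
  unfolding smooth_on_def by (rule allI, rule Ck_on_local) blast

lemma smooth_on_const: "open S \<Longrightarrow> smooth_on S (\<lambda>x. c)"
  by (simp add: smooth_on_def Ck_on_const)

lemma smooth_on_bounded_linear: "open S \<Longrightarrow> bounded_linear L \<Longrightarrow> smooth_on S L"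
  by (simp add: smooth_on_def Ck_on_bounded_linear)

lemma smooth_on_inner_left: "open S \<Longrightarrow> smooth_on S f \<Longrightarrow> smooth_on S (\<lambda>x. f x \<bullet> b)"
  by (simp add: smooth_on_def Ck_on_compose_bounded_linear[OF _ bounded_linear_inner_left])

lemma smooth_on_add:
  "open S \<Longrightarrow> smooth_on S f \<Longrightarrow> smooth_on S g \<Longrightarrow> smooth_on S (\<lambda>x. f x + g x)"
  by (simp add: smooth_on_def Ck_on_add)

lemma smooth_on_scaleR:
  "open S \<Longrightarrow> smooth_on S a \<Longrightarrow> smooth_on S g \<Longrightarrow> smooth_on S (\<lambda>x. a x *\<^sub>R g x)"
  by (simp add: smooth_on_def Ck_on_scaleR)

lemma smooth_on_mult:
  "open S \<Longrightarrow> smooth_on S a \<Longrightarrow> smooth_on S g \<Longrightarrow> smooth_on S (\<lambda>x. a x * g x :: real)"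
  using smooth_on_scaleR[of S a g] by simp

lemma smooth_on_diff:
  assumes "open S" "smooth_on S f" "smooth_on S g"
  shows "smooth_on S (\<lambda>x. f x - g x :: real)"
  using smooth_on_add[OF assms(1,2) smooth_on_mult[OF assms(1) smooth_on_const[OF assms(1), of "-1"] assms(3)]]
  by simp

lemma smooth_on_sum:
  "open S \<Longrightarrow> (\<And>i. i \<in> I \<Longrightarrow> smooth_on S (f i)) \<Longrightarrow> smooth_on S (\<lambda>x. \<Sum>i\<in>I. f i x)"
  by (simp add: smooth_on_def Ck_on_sum)

lemma smooth_on_prod:
  fixes f :: "'i \<Rightarrow> 'a::real_normed_vector \<Rightarrow> real"
  shows "open S \<Longrightarrow> (\<And>i. i \<in> I \<Longrightarrow> smooth_on S (f i)) \<Longrightarrow> smooth_on S (\<lambda>x. \<Prod>i\<in>I. f i x)"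
  by (induction I rule: infinite_finite_induct) (simp_all add: smooth_on_const smooth_on_mult)

lemma smooth_on_compose:
  fixes B :: "'e::real_inner set" and g :: "'a::real_normed_vector \<Rightarrow> 'e"
  shows "is_frame B \<Longrightarrow> open S \<Longrightarrow> open T \<Longrightarrow> smooth_on S g \<Longrightarrow> g ` S \<subseteq> T \<Longrightarrow> smooth_on T f
    \<Longrightarrow> smooth_on S (\<lambda>x. f (g x))"
  unfolding smooth_on_def by (rule allI, rule Ck_on_compose) auto

lemma is_frame_real: "is_frame {1::real}"
  by (simp add: is_frame_def)

lemma smooth_on_has_derivative:
  "smooth_on S f \<Longrightarrow> x \<in> S \<Longrightarrow> (f has_derivative frechet_derivative f (at x)) (at x)"
  unfolding smooth_on_def by (intro Ck_on_Suc_has_derivative) auto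

lemma smooth_on_frechet_derivative:
  assumes "smooth_on S f"
  shows "smooth_on S (\<lambda>x. frechet_derivative f (at x) v)"
  unfolding smooth_on_def
proof
  show "Ck_on k S (\<lambda>x. frechet_derivative f (at x) v)" for k
    using assms Ck_on.simps(2)[of k S f] unfolding smooth_on_def by blast
qed

lemma smooth_on_imp_continuous_on: "smooth_on S f \<Longrightarrow> continuous_on S f"
  unfolding smooth_on_def using Ck_on.simps(1)[of S f] by blast

text \<open>The derivative is a product of \<open>inverse\<close> with itself and a constant, so the
  induction on the order closes.\<close>

lemma smooth_on_inverse: "smooth_on (- {0}) (inverse :: real \<Rightarrow> real)"
proof -
  have "Ck_on k (- {0}) (inverse :: real \<Rightarrow> real)" for k
  proof (induction k)
    case 0
    then show ?case
      by (auto intro!: continuous_on_inverse continuous_on_id)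
  next
    case (Suc k)
    show ?case
    proof (rule Ck_on_SucI[where D = "\<lambda>x v. inverse x *\<^sub>R inverse x *\<^sub>R (- v)"])
      show "Ck_on k (- {0}) (\<lambda>x::real. inverse x *\<^sub>R inverse x *\<^sub>R - v)" for v :: real
        by (intro Ck_on_scaleR Suc Ck_on_const) auto
    qed (auto intro!: derivative_eq_intros simp: fun_eq_iff)
  qed
  then show ?thesis
    by (simp add: smooth_on_def)
qed

lemma smooth_on_divide:
  fixes f g :: "'a::real_normed_vector \<Rightarrow> real"
  assumes "open S" "smooth_on S f" "smooth_on S g" "\<And>x. x \<in> S \<Longrightarrow> g x \<noteq> 0"
  shows "smooth_on S (\<lambda>x. f x / g x)"
proof -
  have "smooth_on S (\<lambda>x. inverse (g x))"
    using assms(4) by (intro smooth_on_compose[OF is_frame_real assms(1) _ assms(3) _ smooth_on_inverse]) auto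
  then show ?thesis
    unfolding divide_inverse by (rule smooth_on_mult[OF assms(1,2)])
qed

section \<open>Cut-off functions\<close>

text \<open>The functions p(1/x) exp(-1/x) for x > 0, extended by 0. Unlike exp(-1/x) alone, this
  class is closed under differentiation, so its smoothness is a single induction over all p at
  once.\<close>

definition exp_poly :: "real poly \<Rightarrow> real \<Rightarrow> real" where
  "exp_poly p x = (if x > 0 then poly p (inverse x) * exp (- inverse x) else 0)"

text \<open>The factor \<open>y ^ k\<close> strengthens the claim for the induction over
  coefficients: the tail of the polynomial carries one more power of y.\<close>

lemma poly_exp_tendsto_0: "((\<lambda>y::real. y ^ k * poly p y * exp (- y)) \<longlongrightarrow> 0) at_top"
proof (induction p arbitrary: k)
  case 0
  then show ?case
    by simp
next
  case (pCons a p)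
  have "((\<lambda>y. a * (y ^ k / exp y) + y ^ Suc k * poly p y * exp (- y)) \<longlongrightarrow> a * 0 + 0) at_top"
    by (intro tendsto_intros tendsto_power_div_exp_0 pCons)
  then show ?case
    by (simp add: algebra_simps exp_minus divide_inverse)
qed

text \<open>With y = 1/x, the derivative of p(y) exp(-y) in x is y^2 (p(y) - p'(y)) exp(-y), and
  \<open>[:0, 0, 1:]\<close> is y^2. Only x = 0 needs a limit.\<close>

lemma exp_poly_has_derivative:
  "(exp_poly p has_real_derivative exp_poly ([:0, 0, 1:] * (p - pderiv p)) x) (at x)"
proof -
  let ?q = "[:0, 0, 1:] * (p - pderiv p)"
  consider "x > 0" | "x = 0" | "x < 0"
    by linarith
  then show ?thesis
  proof cases
    case 1
    have "((\<lambda>x. poly p (inverse x) * exp (- inverse x)) has_real_derivative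
        exp_poly ?q x) (at x)"
      using 1 by (auto intro!: derivative_eq_intros DERIV_chain2[OF poly_DERIV]
          simp: exp_poly_def power2_eq_square algebra_simps)
    moreover have "eventually (\<lambda>x. exp_poly p x = poly p (inverse x) * exp (- inverse x)) (nhds x)"
      using eventually_nhds_in_open[of "{0<..}" x] 1
      by (auto elim!: eventually_mono simp: exp_poly_def)
    ultimately show ?thesis
      by (subst DERIV_cong_ev[OF refl _ refl]) auto
  next
    case 2
    \<comment> \<open>Substituting h = 1/x turns the right difference quotient into x p(x) exp(-x),
      with x tending to infinity.\<close>
    have "((\<lambda>h. (exp_poly p (0 + h) - exp_poly p 0) / h) \<longlongrightarrow> 0) (at_right 0)"
    proof (subst filterlim_at_right_to_top)
      have "eventually (\<lambda>x. x ^ 1 * poly p x * exp (- x)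
          = (exp_poly p (0 + inverse x) - exp_poly p 0) / inverse x) at_top"
        using eventually_gt_at_top[of "0::real"]
        by eventually_elim (simp add: exp_poly_def field_simps)
      then show "((\<lambda>x. (exp_poly p (0 + inverse x) - exp_poly p 0) / inverse x) \<longlongrightarrow> 0) at_top"
        by (rule Lim_transform_eventually[OF poly_exp_tendsto_0])
    qed
    moreover have "((\<lambda>h. (exp_poly p (0 + h) - exp_poly p 0) / h) \<longlongrightarrow> 0) (at_left 0)"
    proof (rule tendsto_eventually)
      show "eventually (\<lambda>h. (exp_poly p (0 + h) - exp_poly p 0) / h = 0) (at_left 0)"
        using eventually_at_left_real[of "-1" "0::real", simplified]
        by eventually_elim (simp add: exp_poly_def)
    qed
    ultimately have "((\<lambda>h. (exp_poly p (0 + h) - exp_poly p 0) / h) \<longlongrightarrow> 0) (at 0)"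
      by (rule filterlim_split_at[rotated])
    then show ?thesis
      using 2 by (simp add: DERIV_def exp_poly_def)
  next
    case 3
    moreover have "eventually (\<lambda>x. exp_poly p x = 0) (nhds x)"
      using eventually_nhds_in_open[of "{..<0}" x] 3
      by (auto elim!: eventually_mono simp: exp_poly_def)
    ultimately show ?thesis
      by (subst DERIV_cong_ev[OF refl _ refl]) (auto simp: exp_poly_def)
  qed
qed

lemma smooth_on_exp_poly: "smooth_on UNIV (exp_poly p)"
proof -
  have "Ck_on k UNIV (exp_poly p)" for k
  proof (induction k arbitrary: p)
    case 0
    show ?case
      using exp_poly_has_derivative DERIV_isCont by (force intro: continuous_at_imp_continuous_on)
  next
    case (Suc k)
    show ?case
    proof (rule Ck_on_SucI)
      show "(exp_poly p has_derivative (\<lambda>v. exp_poly ([:0, 0, 1:] * (p - pderiv p)) x *\<^sub>R v)) (at x)"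
        for x
        using exp_poly_has_derivative[of p x] by (simp add: has_field_derivative_def)
      show "Ck_on k UNIV (\<lambda>x. exp_poly ([:0, 0, 1:] * (p - pderiv p)) x *\<^sub>R v)" for v :: real
        by (rule Ck_on_scaleR[OF open_UNIV Suc.IH Ck_on_const[OF open_UNIV]])
    qed simp
  qed
  then show ?thesis
    by (simp add: smooth_on_def)
qed

definition flat_exp :: "real \<Rightarrow> real" where
  "flat_exp = exp_poly 1"

lemma flat_exp_pos_iff: "flat_exp x > 0 \<longleftrightarrow> x > 0"
  and flat_exp_nonneg: "flat_exp x \<ge> 0"
  and flat_exp_eq_0: "x \<le> 0 \<Longrightarrow> flat_exp x = 0"
  by (auto simp: flat_exp_def exp_poly_def)

lemma smooth_on_flat_exp: "smooth_on UNIV flat_exp"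
  by (simp add: flat_exp_def smooth_on_exp_poly)

definition smooth_step :: "real \<Rightarrow> real" where
  "smooth_step t = flat_exp t / (flat_exp t + flat_exp (1 - t))"

lemma smooth_step_denominator: "flat_exp t + flat_exp (1 - t) > 0"
  using flat_exp_pos_iff[of t] flat_exp_pos_iff[of "1 - t"] flat_exp_nonneg[of t]
    flat_exp_nonneg[of "1 - t"] by (cases "t > 0") (auto intro: add_pos_nonneg add_nonneg_pos)

lemma smooth_step_eq_1: "t \<ge> 1 \<Longrightarrow> smooth_step t = 1"
  using smooth_step_denominator[of t] by (simp add: smooth_step_def flat_exp_eq_0)

lemma smooth_step_eq_0: "t \<le> 0 \<Longrightarrow> smooth_step t = 0"
  by (simp add: smooth_step_def flat_exp_eq_0)

lemma smooth_on_smooth_step: "smooth_on UNIV smooth_step"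
proof -
  have "smooth_on UNIV (\<lambda>t::real. 1 - t)"
    by (rule smooth_on_diff[OF open_UNIV smooth_on_const smooth_on_bounded_linear]) auto
  then have "smooth_on UNIV (\<lambda>t. flat_exp (1 - t))"
    by (rule smooth_on_compose[OF is_frame_real open_UNIV open_UNIV _ _ smooth_on_flat_exp]) auto
  then have "smooth_on UNIV (\<lambda>t. flat_exp t / (flat_exp t + flat_exp (1 - t)))"
    using smooth_step_denominator
    by (intro smooth_on_divide[OF open_UNIV smooth_on_flat_exp] smooth_on_add[OF open_UNIV smooth_on_flat_exp])
      (auto simp: less_le)
  then show ?thesis
    by (simp add: smooth_step_def[abs_def])
qed

section \<open>Finite-dimensional inner product spaces\<close>

lemma finite_dimensional_imp_frame:
  assumes "finite_dimensional TYPE('e::real_inner)"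
  shows "\<exists>B::'e set. is_frame B"
proof -
  obtain A :: "'e set" where "finite A" "span A = UNIV"
    using assms by (auto simp: finite_dimensional_def)
  then obtain C :: "'e set" where C: "finite C" "span C = UNIV" "pairwise orthogonal C"
    using basis_orthogonal[of A] by auto
  \<comment> \<open>An orthogonal spanning set may contain 0. Its normalisation is again 0, because
    the inverse of 0 is 0; hence the extra case for \<open>b = 0\<close> below.\<close>
  define B where "B = (\<lambda>c. c /\<^sub>R norm c) ` C"
  have fin: "finite B"
    by (simp add: B_def C)
  have orth: "b \<bullet> c = (if b = c then if b = 0 then 0 else 1 else 0)" if bc: "b \<in> B" "c \<in> B" for b c
  proof -
    obtain x y where xy: "b = x /\<^sub>R norm x" "c = y /\<^sub>R norm y" "x \<in> C" "y \<in> C"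
      using bc unfolding B_def by blast
    show ?thesis
    proof (cases "b = c")
      case True
      have "b \<bullet> b = (norm b)\<^sup>2"
        by (rule dot_square_norm)
      then show ?thesis
        using True xy(1) by auto
    next
      case False
      then have "x \<bullet> y = 0"
        using xy C(3) by (auto simp: pairwise_def orthogonal_def)
      then show ?thesis
        using xy(1,2) False by simp
    qed
  qed
  have "(\<Sum>b\<in>B. (v \<bullet> b) *\<^sub>R b) = v" for v
  proof -
    \<comment> \<open>The residual of the expansion is orthogonal to \<open>B\<close>, hence to the
      span of \<open>C\<close>, hence to itself.\<close>
    define w where "w = (\<Sum>b\<in>B. (v \<bullet> b) *\<^sub>R b) - v"
    have "w \<bullet> c = 0" if "c \<in> B" for c
    proof -
      have "(\<Sum>b\<in>B. (v \<bullet> b) *\<^sub>R b) \<bullet> c = (\<Sum>b\<in>B. if b = c then v \<bullet> c else 0)"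
        unfolding inner_sum_left using orth[OF _ that] by (intro sum.cong) auto
      then show ?thesis
        using that fin by (simp add: w_def inner_diff_left)
    qed
    moreover have "c /\<^sub>R norm c \<in> B" if "c \<in> C" for c
      using that by (simp add: B_def)
    ultimately have "w \<bullet> (c /\<^sub>R norm c) = 0" if "c \<in> C" for c
      using that by blast
    then have "orthogonal w c" if "c \<in> C" for c
      using that by (cases "c = 0") (auto simp: orthogonal_def)
    then have "orthogonal w w"
      using orthogonal_to_span[of w C w] C(2) by auto
    then show ?thesis
      by (simp add: w_def orthogonal_def)
  qed
  with fin show ?thesis
    unfolding is_frame_def by blast
qed

lemma is_frame_span: "is_frame B \<Longrightarrow> span B = UNIV"
  unfolding is_frame_def by (metis (no_types, lifting) UNIV_eq_I span_base span_scale span_sum)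

lemma is_frame_norm_le:
  assumes "is_frame B"
  shows "norm v \<le> (\<Sum>b\<in>B. \<bar>v \<bullet> b\<bar> * norm b)"
proof -
  have "norm v = norm (\<Sum>b\<in>B. (v \<bullet> b) *\<^sub>R b)"
    using assms by (simp add: is_frame_def)
  also have "\<dots> \<le> (\<Sum>b\<in>B. norm ((v \<bullet> b) *\<^sub>R b))"
    by (rule norm_sum)
  finally show ?thesis
    by simp
qed

text \<open>As a type, \<open>'e\<close> is only an inner product space, so compactness of balls is
  obtained from boxes of coefficients. Each new direction adds a product with an interval, followed
  by a continuous map.\<close>

lemma compact_bounded_combinations:
  fixes B :: "'e::real_normed_vector set"
  assumes "finite B"
  shows "compact ((\<lambda>a. \<Sum>b\<in>B. a b *\<^sub>R b) ` {a. \<forall>b\<in>B. \<bar>a b\<bar> \<le> R})"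
  using assms
proof (induction B)
  case empty
  then show ?case
    by (simp add: image_constant_conv)
next
  case (insert c B)
  let ?K = "\<lambda>B. (\<lambda>a. \<Sum>b\<in>B. a b *\<^sub>R b) ` {a. \<forall>b\<in>B. \<bar>a b\<bar> \<le> R}"
  have "?K (insert c B) = (\<lambda>(t, w). t *\<^sub>R c + w) ` ({-R..R} \<times> ?K B)"
  proof (intro set_eqI iffI)
    fix v
    assume "v \<in> ?K (insert c B)"
    then obtain a where a: "v = (\<Sum>b\<in>insert c B. a b *\<^sub>R b)" "\<forall>b\<in>insert c B. \<bar>a b\<bar> \<le> R"
      by auto
    then have "v = (\<lambda>(t, w). t *\<^sub>R c + w) (a c, \<Sum>b\<in>B. a b *\<^sub>R b)"
      using insert by simp
    moreover have "(a c, \<Sum>b\<in>B. a b *\<^sub>R b) \<in> {-R..R} \<times> ?K B"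
      using a(2) by (auto simp: abs_le_iff)
    ultimately show "v \<in> (\<lambda>(t, w). t *\<^sub>R c + w) ` ({-R..R} \<times> ?K B)"
      by blast
  next
    fix v
    assume "v \<in> (\<lambda>(t, w). t *\<^sub>R c + w) ` ({-R..R} \<times> ?K B)"
    then obtain t a where a: "v = t *\<^sub>R c + (\<Sum>b\<in>B. a b *\<^sub>R b)" "\<bar>t\<bar> \<le> R" "\<forall>b\<in>B. \<bar>a b\<bar> \<le> R"
      by (auto simp: abs_le_iff)
    have "v = (\<Sum>b\<in>insert c B. (a(c := t)) b *\<^sub>R b)"
      using insert a(1) by (auto intro!: sum.cong)
    then show "v \<in> ?K (insert c B)"
      using a by (intro image_eqI[of _ _ "a(c := t)"]) auto
  qed
  moreover have "compact \<dots>"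
    by (intro compact_continuous_image compact_Times insert.IH)
      (auto simp: case_prod_beta intro!: continuous_intros)
  ultimately show ?case
    by metis
qed

lemma compact_cball_frame:
  fixes B :: "'e::real_inner set" and x :: 'e
  assumes B: "is_frame B"
  shows "compact (cball x r)"
proof -
  \<comment> \<open>A Cauchy-Schwarz bound for the coefficients: the first factor bounds the norms
    in the ball, the second bounds each \<open>norm b\<close>.\<close>
  define R where "R = (norm x + \<bar>r\<bar>) * (\<Sum>b\<in>B. norm b)"
  let ?K = "(\<lambda>a. \<Sum>b\<in>B. a b *\<^sub>R b) ` {a. \<forall>b\<in>B. \<bar>a b\<bar> \<le> R}"
  have fin: "finite B"
    using B by (simp add: is_frame_def)
  have "cball x r \<subseteq> ?K"
  proof
    fix v
    assume v: "v \<in> cball x r"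
    then have "norm v \<le> norm x + \<bar>r\<bar>"
      using norm_triangle_sub[of v x] by (auto simp: dist_norm norm_minus_commute)
    moreover have "norm b \<le> (\<Sum>b\<in>B. norm b)" if "b \<in> B" for b
      using member_le_sum[OF that, of norm] fin by simp
    ultimately have "\<bar>v \<bullet> b\<bar> \<le> R" if "b \<in> B" for b
      unfolding R_def using that by (intro order.trans[OF Cauchy_Schwarz_ineq2] mult_mono) auto
    then show "v \<in> ?K"
      using B by (intro image_eqI[of _ _ "\<lambda>b. v \<bullet> b"]) (auto simp: is_frame_def)
  qed
  then show ?thesis
    using compact_Int_closed[OF compact_bounded_combinations[OF fin, of R] closed_cball[of x r]]
    by (simp add: Int_absorb1)
qed

text \<open>
  Proved by pivoting. What matters is that the constant does not depend on the number of functionals.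
\<close>

lemma controlling_functionals:
  fixes f :: "'i \<Rightarrow> 'e::real_vector \<Rightarrow> real"
  assumes I: "finite I" "\<And>i. i \<in> I \<Longrightarrow> linear (f i)"
  shows "finite T \<Longrightarrow> card T \<le> k \<Longrightarrow> \<exists>J\<subseteq>I. card J \<le> k \<and>
    (\<forall>v\<in>span T. \<forall>e\<ge>0. (\<forall>j\<in>J. \<bar>f j v\<bar> \<le> e) \<longrightarrow> (\<forall>i\<in>I. \<bar>f i v\<bar> \<le> 3 ^ k * e))"
proof (induction k arbitrary: T)
  case 0
  then have "T = {}"
    by simp
  then show ?case
    using I(2) by (auto intro!: exI[of _ "{}"] simp: linear_0)
next
  case (Suc k)
  show ?case
  proof (cases "\<forall>t\<in>T. \<forall>i\<in>I. f i t = 0")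
    case True
    then have "f i v = 0" if "i \<in> I" "v \<in> span T" for i v
      using linear_eq_0_on_span[OF I(2)[OF that(1)] _ that(2)] that(1) by blast
    then show ?thesis
      by (intro exI[of _ "{}"]) auto
  next
    case False
    then obtain t i where t: "t \<in> T" "i \<in> I" "f i t \<noteq> 0"
      by blast
    \<comment> \<open>The pivot: since \<open>f m\<close> is the largest functional at t, all ratios
      to it are at most 1, however many functionals there are.\<close>
    obtain m where m: "m \<in> I" "\<And>i. i \<in> I \<Longrightarrow> \<bar>f i t\<bar> \<le> \<bar>f m t\<bar>"
    proof -
      have "finite ((\<lambda>i. \<bar>f i t\<bar>) ` I)" "(\<lambda>i. \<bar>f i t\<bar>) ` I \<noteq> {}"
        using I t by auto
      then obtain m where "m \<in> I" "Max ((\<lambda>i. \<bar>f i t\<bar>) ` I) = \<bar>f m t\<bar>"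
        using Max_in by blast
      moreover have "\<bar>f i t\<bar> \<le> Max ((\<lambda>i. \<bar>f i t\<bar>) ` I)" if "i \<in> I" for i
        using I(1) that by (intro Max_ge) auto
      ultimately show thesis
        using that by simp
    qed
    have nz: "f m t \<noteq> 0"
      using m(2)[OF t(2)] t(3) by auto
    \<comment> \<open>The projection along t onto the kernel of \<open>f m\<close>. It kills t, so
      the image of \<open>span T\<close> is spanned by the images of the remaining vectors.\<close>
    define P where "P v = v - (f m v / f m t) *\<^sub>R t" for v
    have lin: "linear P"
      unfolding P_def
      by (rule linearI) (simp_all add: linear_add[OF I(2)[OF m(1)]] linear_scale[OF I(2)[OF m(1)]]
          add_divide_distrib algebra_simps)
    have "card (P ` (T - {t})) \<le> k"
      using Suc.prems t(1) card_image_le[of "T - {t}" P] by (simp add: card_Diff_singleton_if)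
    then obtain J where J: "J \<subseteq> I" "card J \<le> k" and
      JI: "\<forall>v\<in>span (P ` (T - {t})). \<forall>e\<ge>0. (\<forall>j\<in>J. \<bar>f j v\<bar> \<le> e) \<longrightarrow> (\<forall>i\<in>I. \<bar>f i v\<bar> \<le> 3 ^ k * e)"
      using Suc.IH[of "P ` (T - {t})"] Suc.prems(1) by auto
    have "P t = 0"
      using nz by (simp add: P_def)
    then have "P ` T = insert 0 (P ` (T - {t}))"
      using t(1) image_insert[of P t "T - {t}"] by (simp add: insert_absorb)
    then have "P ` span T = span (P ` (T - {t}))"
      using linear_span_image[OF lin, of T] by simp
    then have span: "P v \<in> span (P ` (T - {t}))" if "v \<in> span T" for v
      using that by blast
    have "card (insert m J) \<le> Suc k"
      using J(2) finite_subset[OF J(1) I(1)] by (simp add: card_insert_if)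
    moreover have "\<bar>f i v\<bar> \<le> 3 ^ Suc k * e"
      if v: "v \<in> span T" and e: "0 \<le> e" "\<forall>j\<in>insert m J. \<bar>f j v\<bar> \<le> e" and i: "i \<in> I" for v e i
    proof -
      have fP: "f i v = f i (P v) + (f m v / f m t) * f i t" if "i \<in> I" for i
        unfolding P_def by (simp add: linear_diff[OF I(2)[OF that]] linear_scale[OF I(2)[OF that]])
      have small: "\<bar>(f m v / f m t) * f i t\<bar> \<le> e" if "i \<in> I" for i
      proof -
        have "\<bar>(f m v / f m t) * f i t\<bar> = \<bar>f m v\<bar> * (\<bar>f i t\<bar> / \<bar>f m t\<bar>)"
          by (simp add: abs_mult)
        also have "\<dots> \<le> \<bar>f m v\<bar> * 1"
          using m(2)[OF that] nz by (intro mult_left_mono) auto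
        finally show ?thesis
          using e by simp
      qed
      \<comment> \<open>Passing between v and \<open>P v\<close> changes every functional by at most
        e. Thus \<open>P v\<close> satisfies the induction hypothesis with 2e, and 3^k * 2e + e
        \<le> 3^(k+1) * e.\<close>
      have "\<bar>f j (P v)\<bar> \<le> 2 * e" if "j \<in> J" for j
      proof -
        have "j \<in> I" "\<bar>f j v\<bar> \<le> e"
          using e(2) that J(1) by auto
        then show ?thesis
          using fP[of j] small[of j] by linarith
      qed
      then have "\<bar>f i (P v)\<bar> \<le> 3 ^ k * (2 * e)"
        using JI[rule_format, OF span[OF v], of "2 * e" i] e(1) i by simp
      moreover have "e \<le> 3 ^ k * e"
        using mult_right_mono[of 1 "3 ^ k" e] e(1) by simp
      moreover have "3 ^ Suc k * e = 3 ^ k * (2 * e) + 3 ^ k * e"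
        by simp
      ultimately show ?thesis
        using fP[OF i] small[OF i] by linarith
    qed
    ultimately show ?thesis
      using J(1) m(1) by (intro exI[of _ "insert m J"]) auto
  qed
qed

text \<open>Strict differentiability: both points move. The packing argument compares two arbitrary
  points near x, for which differentiability at x alone gives too little.\<close>

lemma smooth_on_strict_differentiable:
  fixes f :: "'e::real_inner \<Rightarrow> real" and B :: "'e set"
  assumes B: "is_frame B" and S: "open S" "x \<in> S" and f: "smooth_on S f" and "\<epsilon> > 0"
  shows "\<exists>\<delta>>0. ball x \<delta> \<subseteq> S \<and> (\<forall>y\<in>ball x \<delta>. \<forall>z\<in>ball x \<delta>.
    \<bar>f y - f z - frechet_derivative f (at x) (y - z)\<bar> \<le> \<epsilon> * norm (y - z))"
proof -
  let ?f = "\<lambda>x. frechet_derivative f (at x)"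
  \<comment> \<open>A bound for the operator norm of the difference of the derivatives at y and x,
    built from directional derivatives along the frame. It is continuous and vanishes at x; the mean
    value inequality then applies on a small ball.\<close>
  define s where "s y = (\<Sum>b\<in>B. norm b * \<bar>?f y b - ?f x b\<bar>)" for y
  have "continuous_on S s"
    unfolding s_def
    by (intro continuous_intros smooth_on_imp_continuous_on smooth_on_frechet_derivative f)
  then have "isCont s x"
    using S continuous_on_eq_continuous_at by blast
  then have "(s \<longlongrightarrow> s x) (nhds x)"
    by (simp add: isCont_def tendsto_at_iff_tendsto_nhds)
  moreover have "s x < \<epsilon>"
    using \<open>\<epsilon> > 0\<close> by (simp add: s_def)
  ultimately have "\<forall>\<^sub>F y in nhds x. s y < \<epsilon>"
    by (rule order_tendstoD(2))
  moreover have "\<forall>\<^sub>F y in nhds x. y \<in> S"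
    using S by (rule eventually_nhds_in_open)
  ultimately have "\<forall>\<^sub>F y in nhds x. y \<in> S \<and> s y < \<epsilon>"
    by eventually_elim simp
  then obtain \<delta> where \<delta>: "\<delta> > 0" "\<And>y. dist y x < \<delta> \<Longrightarrow> y \<in> S \<and> s y < \<epsilon>"
    unfolding eventually_nhds_metric by blast
  have der: "(f has_derivative ?f y) (at y)" if "y \<in> ball x \<delta>" for y
    using \<delta>(2)[of y] that f smooth_on_has_derivative by (metis dist_commute mem_ball)
  have on: "onorm (?f y - ?f x) \<le> \<epsilon>" if y: "y \<in> ball x \<delta>" for y
  proof (rule onorm_bound)
    show "0 \<le> \<epsilon>"
      using \<open>\<epsilon> > 0\<close> by simp
    fix v
    have lin: "linear (\<lambda>v. ?f y v - ?f x v)"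
      using der[OF y] der[of x] \<delta>(1) by (intro linear_compose_sub has_derivative_linear) auto
    have "norm (?f y v - ?f x v) = \<bar>\<Sum>b\<in>B. (v \<bullet> b) *\<^sub>R (?f y b - ?f x b)\<bar>"
      using linear_frame[OF B lin, of v] by simp
    also have "\<dots> \<le> (\<Sum>b\<in>B. \<bar>v \<bullet> b\<bar> * \<bar>?f y b - ?f x b\<bar>)"
      by (rule order.trans[OF sum_abs]) (simp add: abs_mult)
    also have "\<dots> \<le> (\<Sum>b\<in>B. (norm v * norm b) * \<bar>?f y b - ?f x b\<bar>)"
      by (intro sum_mono mult_right_mono Cauchy_Schwarz_ineq2) auto
    also have "\<dots> = s y * norm v"
      by (simp add: s_def sum_distrib_left sum_distrib_right mult_ac)
    also have "\<dots> \<le> \<epsilon> * norm v"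
      using \<delta>(2)[of y] y by (intro mult_right_mono) (auto simp: dist_commute)
    finally show "norm ((?f y - ?f x) v) \<le> \<epsilon> * norm v"
      by simp
  qed
  have "\<bar>f y - f z - ?f x (y - z)\<bar> \<le> \<epsilon> * norm (y - z)"
    if y: "y \<in> ball x \<delta>" and z: "z \<in> ball x \<delta>" for y z
  proof -
    have "z + t *\<^sub>R (y - z) \<in> ball x \<delta>" if "t \<in> {0..1}" for t
      using convexD[OF convex_ball z y, of "1 - t" t] that by (simp add: algebra_simps)
    then have "norm (f y - f z - ?f x (y - z)) \<le> norm (y - z) * \<epsilon>"
      using on \<delta>(1) der
      by (intro differentiable_bound_linearization[of z y "ball x \<delta>" f ?f x]) (auto intro: has_derivative_at_withinI)
    then show ?thesis
      by (simp add: mult.commute)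
  qed
  with \<delta> show ?thesis
    by (intro exI[of _ \<delta>]) (auto simp: dist_commute)
qed

section \<open>Packing and colouring\<close>

text \<open>Box counting: points in the same cell of a grid of side \<delta> differ by less than
  \<delta> in every coordinate, and each coordinate meets at most 2K cells.\<close>

lemma card_separated_le:
  fixes F :: "'i \<Rightarrow> 'a \<Rightarrow> real" and K :: nat and \<delta> :: real
  assumes "finite J" "\<delta> > 0"
    and near: "\<And>q j. q \<in> Q \<Longrightarrow> j \<in> J \<Longrightarrow> \<bar>F j q - c j\<bar> < K * \<delta>"
    and sep: "\<And>q q'. q \<in> Q \<Longrightarrow> q' \<in> Q \<Longrightarrow> q \<noteq> q' \<Longrightarrow> \<exists>j\<in>J. \<bar>F j q - F j q'\<bar> \<ge> \<delta>"
  shows "finite Q \<and> card Q \<le> (2 * K) ^ card J"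
proof -
  define g where "g q = (\<lambda>j\<in>J. \<lfloor>(F j q - c j) / \<delta>\<rfloor>)" for q
  let ?E = "J \<rightarrow>\<^sub>E {- int K..<int K}"
  have "g ` Q \<subseteq> ?E"
  proof
    fix e
    assume "e \<in> g ` Q"
    then obtain q where q: "q \<in> Q" "e = g q"
      by blast
    have "\<lfloor>(F j q - c j) / \<delta>\<rfloor> \<in> {- int K..<int K}" if "j \<in> J" for j
    proof -
      have "- real K \<le> (F j q - c j) / \<delta>" "(F j q - c j) / \<delta> < real K"
        using near[OF q(1) that] \<open>\<delta> > 0\<close> by (auto simp: field_simps abs_less_iff)
      then show ?thesis
        by (auto simp: le_floor_iff floor_less_iff)
    qed
    then show "e \<in> ?E"
      by (auto simp: q g_def)
  qed
  moreover have "inj_on g Q"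
  proof (rule inj_onI, rule ccontr)
    fix q q'
    assume q: "q \<in> Q" "q' \<in> Q" "g q = g q'" "q \<noteq> q'"
    then obtain j where j: "j \<in> J" "\<bar>F j q - F j q'\<bar> \<ge> \<delta>"
      using sep by blast
    define u u' where "u = (F j q - c j) / \<delta>" and "u' = (F j q' - c j) / \<delta>"
    have "\<lfloor>u\<rfloor> = \<lfloor>u'\<rfloor>"
      using fun_cong[OF q(3), of j] j(1) by (simp add: g_def u_def u'_def)
    then have "\<bar>u - u'\<bar> < 1"
      by linarith
    moreover have "F j q - F j q' = (u - u') * \<delta>"
      using \<open>\<delta> > 0\<close> by (simp add: u_def u'_def field_simps)
    ultimately have "\<bar>F j q - F j q'\<bar> < \<delta>"
      using \<open>\<delta> > 0\<close> by (simp add: abs_mult)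
    with j(2) show False
      by simp
  qed
  moreover have "finite ?E" "card ?E = (2 * K) ^ card J"
    using assms(1) by (simp_all add: finite_PiE card_PiE nat_mult_distrib)
  ultimately show ?thesis
    by (metis card_inj_on_le inj_on_finite)
qed

text \<open>The point inserted last has fewer than N neighbours, so one of the N colours is still
  free for it.\<close>

lemma greedy_colouring:
  assumes "finite P" and sym: "\<And>p q. R p q \<Longrightarrow> R q p"
    and "\<And>p. p \<in> P \<Longrightarrow> card {q \<in> P. R p q} < N"
  shows "\<exists>col::'a \<Rightarrow> nat. (\<forall>p\<in>P. col p < N) \<and>
    (\<forall>p\<in>P. \<forall>q\<in>P. p \<noteq> q \<and> R p q \<longrightarrow> col p \<noteq> col q)"
  using assms(1,3)
proof (induction P)
  case empty
  then show ?case
    by simp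
next
  case (insert x P)
  have le: "card {q \<in> P. R p q} \<le> card {q \<in> insert x P. R p q}" for p
    using insert.hyps by (intro card_mono) auto
  have small: "card {q \<in> P. R p q} < N" if "p \<in> P" for p
    using le[of p] insert.prems[of p] that by (meson insertI2 le_less_trans)
  then have "\<exists>col. (\<forall>p\<in>P. col p < N) \<and>
      (\<forall>p\<in>P. \<forall>q\<in>P. p \<noteq> q \<and> R p q \<longrightarrow> col p \<noteq> col q)"
    by (rule insert.IH)
  then obtain col where col: "\<forall>p\<in>P. col p < N"
    "\<forall>p\<in>P. \<forall>q\<in>P. p \<noteq> q \<and> R p q \<longrightarrow> col p \<noteq> col q"
    by (elim exE conjE)
  let ?U = "col ` {q \<in> P. R x q}"
  have "card ?U \<le> card {q \<in> P. R x q}"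
    using insert.hyps by (intro card_image_le) simp
  also have "\<dots> < card {..<N}"
    using le[of x] insert.prems[OF insertI1] by (simp only: card_lessThan le_less_trans)
  finally have lt: "card ?U < card {..<N}" .
  have "\<not> {..<N} \<subseteq> ?U"
  proof
    assume "{..<N} \<subseteq> ?U"
    then have "card {..<N} \<le> card ?U"
      by (rule card_mono[rotated]) (simp add: insert.hyps(1))
    with lt show False
      by simp
  qed
  then obtain n where n: "n < N" "n \<notin> ?U"
    by blast
  show ?case
  proof (intro exI[of _ "col(x := n)"] conjI ballI impI)
    fix p q
    assume pq: "p \<in> insert x P" "q \<in> insert x P" "p \<noteq> q \<and> R p q"
    then show "(col(x := n)) p \<noteq> (col(x := n)) q"
    proof (cases "p = x \<or> q = x")
      case True
      then show ?thesis
        using n(2) sym[of p q] pq by auto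
    next
      case False
      then show ?thesis
        using col(2) pq by simp
    qed
  qed (use n(1) col(1) in auto)
qed

section \<open>Smooth maps on manifolds\<close>

locale framed_manifold =
  fixes M :: "'a topology" and \<A> :: "('a, 'e::real_inner) chart set" and B :: "'e set"
  assumes manifold: "smooth_manifold M \<A>" and frame: "is_frame B"
begin

lemma Hausdorff: "Hausdorff_space M"
  and charts_cover: "(\<Union>c\<in>\<A>. chart_dom c) = topspace M"
  and is_chart: "c \<in> \<A> \<Longrightarrow> is_chart M c"
  and compatible: "c \<in> \<A> \<Longrightarrow> d \<in> \<A> \<Longrightarrow> smoothly_compatible c d"
  using manifold by (auto simp: smooth_manifold_def smooth_structure_def smooth_atlas_def)

lemma chart_at:
  assumes "p \<in> topspace M"
  obtains c where "c \<in> \<A>" "p \<in> chart_dom c"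
  using assms charts_cover by blast

lemma openin_chart_dom: "c \<in> \<A> \<Longrightarrow> openin M (chart_dom c)"
  and open_chart_img: "c \<in> \<A> \<Longrightarrow> open (chart_img c)"
  and homeomorphic_chart: "c \<in> \<A> \<Longrightarrow>
    homeomorphic_map (subtopology M (chart_dom c)) (top_of_set (chart_img c)) (chart_map c)"
  using is_chart by (auto simp: is_chart_def)

lemma chart_dom_subset: "c \<in> \<A> \<Longrightarrow> chart_dom c \<subseteq> topspace M"
  using openin_chart_dom openin_subset by blast

lemma inj_on_chart: "c \<in> \<A> \<Longrightarrow> inj_on (chart_map c) (chart_dom c)"
  using homeomorphic_imp_injective_map[OF homeomorphic_chart, of c] chart_dom_subset[of c]
  by (simp add: Int_absorb1)

lemma chart_inv_chart_map: "c \<in> \<A> \<Longrightarrow> p \<in> chart_dom c \<Longrightarrow> chart_inv c (chart_map c p) = p"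
  by (simp add: chart_inv_def inj_on_chart)

lemma chart_map_chart_inv: "x \<in> chart_img c \<Longrightarrow> chart_map c (chart_inv c x) = x"
  unfolding chart_inv_def chart_img_def by (rule f_inv_into_f)

lemma chart_inv_in_dom: "x \<in> chart_img c \<Longrightarrow> chart_inv c x \<in> chart_dom c"
  unfolding chart_inv_def chart_img_def by (rule inv_into_into)

lemma chart_map_in_img: "p \<in> chart_dom c \<Longrightarrow> chart_map c p \<in> chart_img c"
  by (simp add: chart_img_def)

lemma open_chart_image:
  assumes "c \<in> \<A>" "openin M V"
  shows "open (chart_map c ` (V \<inter> chart_dom c))"
proof -
  have "openin (subtopology M (chart_dom c)) (V \<inter> chart_dom c)"
    using assms(2) by (auto simp: openin_subtopology)
  then have "openin (top_of_set (chart_img c)) (chart_map c ` (V \<inter> chart_dom c))"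
    using homeomorphic_imp_open_map[OF homeomorphic_chart[OF assms(1)]] by (simp add: open_map_def)
  then show ?thesis
    using open_chart_img[OF assms(1)] openin_open_trans by blast
qed

lemma openin_chart_preimage:
  assumes c: "c \<in> \<A>" and "open S"
  shows "openin M {p \<in> chart_dom c. chart_map c p \<in> S}"
proof -
  have "continuous_map (subtopology M (chart_dom c)) euclidean (chart_map c)"
    using homeomorphic_imp_continuous_map[OF homeomorphic_chart[OF c]]
      continuous_map_into_fulltopology by blast
  then have "openin (subtopology M (chart_dom c))
      {p \<in> topspace (subtopology M (chart_dom c)). chart_map c p \<in> S}"
    using \<open>open S\<close> by (intro openin_continuous_map_preimage) auto
  then show ?thesis
    using openin_trans_full[OF _ openin_chart_dom[OF c]] chart_dom_subset[OF c]
    by (simp add: topspace_subtopology_subset del: topspace_subtopology)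
qed

lemma compactin_chart_inv_image:
  assumes c: "c \<in> \<A>" and K: "compact K" "K \<subseteq> chart_img c"
  shows "compactin M (chart_inv c ` K)"
proof -
  obtain g where g: "homeomorphic_maps (subtopology M (chart_dom c)) (top_of_set (chart_img c)) (chart_map c) g"
    using homeomorphic_chart[OF c] by (auto simp: homeomorphic_map_maps)
  have "continuous_map (top_of_set (chart_img c)) M g"
    using g by (auto simp: homeomorphic_maps_def continuous_map_in_subtopology)
  moreover have "g x = chart_inv c x" if "x \<in> chart_img c" for x
  proof -
    have "x = chart_map c (chart_inv c x)"
      by (simp add: chart_map_chart_inv that)
    moreover have "g (chart_map c (chart_inv c x)) = chart_inv c x"
      using g chart_inv_in_dom[OF that] chart_dom_subset[OF c]
      by (auto simp: homeomorphic_maps_def)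
    ultimately show ?thesis
      by simp
  qed
  ultimately have "continuous_map (top_of_set (chart_img c)) M (chart_inv c)"
    by (auto elim: continuous_map_eq)
  moreover have "compactin (top_of_set (chart_img c)) K"
    using K by (simp add: compactin_subtopology)
  ultimately show ?thesis
    using image_compactin by blast
qed

section \<open>Smoothness read in one chart\<close>

text \<open>The chart is a parameter because the functions of interest may depend on it, as the
  component \<open>X p c\<close> of a vector field does. \<open>V\<close> need not lie in the chart
  domain.\<close>

definition smooth_in :: "('a, 'e) chart \<Rightarrow> 'a set \<Rightarrow> ('a \<Rightarrow> 'b::real_normed_vector) \<Rightarrow> bool" where
  "smooth_in c V F \<longleftrightarrow> smooth_on (chart_map c ` (V \<inter> chart_dom c)) (\<lambda>x. F (chart_inv c x))"

lemma smooth_in_cong: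
  assumes "c \<in> \<A>" "openin M V" "\<And>p. p \<in> V \<Longrightarrow> p \<in> chart_dom c \<Longrightarrow> F p = G p"
  shows "smooth_in c V F \<longleftrightarrow> smooth_in c V G"
  unfolding smooth_in_def using assms
  by (intro smooth_on_cong open_chart_image) (auto simp: chart_inv_chart_map)

lemma smooth_in_subset: "smooth_in c V F \<Longrightarrow> W \<inter> chart_dom c \<subseteq> V \<Longrightarrow> smooth_in c W F"
  unfolding smooth_in_def by (erule smooth_on_subset) blast

lemma smooth_in_local:
  assumes "c \<in> \<A>"
    and "\<And>p. p \<in> V \<Longrightarrow> p \<in> chart_dom c \<Longrightarrow> \<exists>W. openin M W \<and> p \<in> W \<and> smooth_in c W F"
  shows "smooth_in c V F"
  unfolding smooth_in_def
proof (rule smooth_on_local)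
  fix x
  assume "x \<in> chart_map c ` (V \<inter> chart_dom c)"
  then obtain p where p: "p \<in> V" "p \<in> chart_dom c" "x = chart_map c p"
    by blast
  obtain W where W: "openin M W" "p \<in> W" "smooth_in c W F"
    using assms(2)[OF p(1,2)] by blast
  show "\<exists>T. open T \<and> x \<in> T \<and> smooth_on T (\<lambda>x. F (chart_inv c x))"
    using p W open_chart_image[OF assms(1) W(1)]
    by (intro exI[of _ "chart_map c ` (W \<inter> chart_dom c)"]) (auto simp: smooth_in_def)
qed

lemma smooth_in_const: "c \<in> \<A> \<Longrightarrow> openin M V \<Longrightarrow> smooth_in c V (\<lambda>p. k)"
  unfolding smooth_in_def by (intro smooth_on_const open_chart_image)

lemma smooth_in_diff:
  fixes F G :: "'a \<Rightarrow> real"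
  shows "c \<in> \<A> \<Longrightarrow> openin M V \<Longrightarrow> smooth_in c V F \<Longrightarrow> smooth_in c V G \<Longrightarrow> smooth_in c V (\<lambda>p. F p - G p)"
  unfolding smooth_in_def by (rule smooth_on_diff[OF open_chart_image])

lemma smooth_in_scaleR:
  "c \<in> \<A> \<Longrightarrow> openin M V \<Longrightarrow> smooth_in c V F \<Longrightarrow> smooth_in c V G \<Longrightarrow> smooth_in c V (\<lambda>p. F p *\<^sub>R G p)"
  unfolding smooth_in_def by (rule smooth_on_scaleR[OF open_chart_image])

lemma smooth_in_mult:
  fixes F G :: "'a \<Rightarrow> real"
  shows "c \<in> \<A> \<Longrightarrow> openin M V \<Longrightarrow> smooth_in c V F \<Longrightarrow> smooth_in c V G \<Longrightarrow> smooth_in c V (\<lambda>p. F p * G p)"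
  unfolding smooth_in_def by (rule smooth_on_mult[OF open_chart_image])

lemma smooth_in_sum:
  "c \<in> \<A> \<Longrightarrow> openin M V \<Longrightarrow> (\<And>i. i \<in> I \<Longrightarrow> smooth_in c V (F i)) \<Longrightarrow> smooth_in c V (\<lambda>p. \<Sum>i\<in>I. F i p)"
  unfolding smooth_in_def by (rule smooth_on_sum[OF open_chart_image])

lemma smooth_in_prod:
  fixes F :: "'i \<Rightarrow> 'a \<Rightarrow> real"
  shows "c \<in> \<A> \<Longrightarrow> openin M V \<Longrightarrow> (\<And>i. i \<in> I \<Longrightarrow> smooth_in c V (F i)) \<Longrightarrow> smooth_in c V (\<lambda>p. \<Prod>i\<in>I. F i p)"
  unfolding smooth_in_def by (rule smooth_on_prod[OF open_chart_image])

lemma smooth_in_inner_left: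
  "c \<in> \<A> \<Longrightarrow> openin M V \<Longrightarrow> smooth_in c V F \<Longrightarrow> smooth_in c V (\<lambda>p. F p \<bullet> b)"
  unfolding smooth_in_def by (rule smooth_on_inner_left[OF open_chart_image])

lemma smooth_in_divide:
  fixes F G :: "'a \<Rightarrow> real"
  assumes "c \<in> \<A>" "openin M V" "smooth_in c V F" "smooth_in c V G"
    and "\<And>p. p \<in> V \<Longrightarrow> p \<in> chart_dom c \<Longrightarrow> G p \<noteq> 0"
  shows "smooth_in c V (\<lambda>p. F p / G p)"
  using assms unfolding smooth_in_def
  by (intro smooth_on_divide[OF open_chart_image]) (auto simp: chart_inv_chart_map)

lemma smooth_in_compose_real:
  fixes F :: "'a \<Rightarrow> real"
  shows "c \<in> \<A> \<Longrightarrow> openin M V \<Longrightarrow> smooth_in c V F \<Longrightarrow> smooth_on UNIV h \<Longrightarrow> smooth_in c V (\<lambda>p. h (F p))"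
  unfolding smooth_in_def by (rule smooth_on_compose[OF is_frame_real open_chart_image open_UNIV]) auto

lemma smooth_in_chart_map:
  assumes "c \<in> \<A>" "openin M V"
  shows "smooth_in c V (chart_map c)"
proof -
  have "smooth_on (chart_map c ` (V \<inter> chart_dom c)) (\<lambda>x. x)"
    using smooth_on_bounded_linear[OF open_chart_image[OF assms] bounded_linear_ident] .
  then show ?thesis
    unfolding smooth_in_def
    by (subst smooth_on_cong[OF open_chart_image[OF assms]]) (auto simp: chart_inv_chart_map[OF assms(1)])
qed

lemma smooth_transition:
  assumes "c \<in> \<A>" "d \<in> \<A>"
  shows "smooth_on (chart_map c ` (chart_dom c \<inter> chart_dom d)) (transition c d)"
  using compatible[OF assms] by (simp add: smoothly_compatible_def)

text \<open>Composition with the smooth transition map. A function supported in a chart therefore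
  has to be checked in that chart only.\<close>

lemma smooth_in_change_chart:
  assumes cd: "c \<in> \<A>" "d \<in> \<A>" and V: "openin M V" and F: "smooth_in d V F"
  shows "smooth_in c (V \<inter> chart_dom d) F"
proof -
  let ?W = "V \<inter> chart_dom d" and ?S = "chart_map c ` ((V \<inter> chart_dom d) \<inter> chart_dom c)"
  have W: "openin M ?W"
    using V openin_chart_dom[OF cd(2)] by blast
  have tr: "transition c d (chart_map c p) = chart_map d p" if "p \<in> chart_dom c" for p
    using that by (simp add: transition_def chart_inv_chart_map[OF cd(1)])
  have "smooth_on ?S (\<lambda>x. F (chart_inv d (transition c d x)))"
  proof (rule smooth_on_compose[OF frame, where T = "chart_map d ` (V \<inter> chart_dom d)"])
    show "smooth_on ?S (transition c d)"
      by (rule smooth_on_subset[OF smooth_transition[OF cd]]) blast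
    show "smooth_on (chart_map d ` (V \<inter> chart_dom d)) (\<lambda>x. F (chart_inv d x))"
      using F by (simp add: smooth_in_def)
    show "transition c d ` ?S \<subseteq> chart_map d ` (V \<inter> chart_dom d)"
      using tr by auto
  qed (intro open_chart_image cd V W)+
  moreover have "F (chart_inv d (transition c d x)) = F (chart_inv c x)" if "x \<in> ?S" for x
    using that by (auto simp: tr chart_inv_chart_map[OF cd(1)] chart_inv_chart_map[OF cd(2)])
  ultimately show ?thesis
    unfolding smooth_in_def by (rule iffD1[OF smooth_on_cong[OF open_chart_image[OF cd(1) W]], rotated])
qed

lemma smooth_in_topspace:
  "c \<in> \<A> \<Longrightarrow> smooth_in c (topspace M) F \<longleftrightarrow> smooth_on (chart_img c) (\<lambda>x. F (chart_inv c x))"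
  using chart_dom_subset[of c] by (simp add: smooth_in_def chart_img_def Int_absorb1)

lemma smooth_function_iff: "smooth_function \<A> f \<longleftrightarrow> (\<forall>c\<in>\<A>. smooth_in c (topspace M) f)"
  by (auto simp: smooth_function_def smooth_in_topspace comp_def)

lemma smooth_functionD: "smooth_function \<A> f \<Longrightarrow> c \<in> \<A> \<Longrightarrow> V \<subseteq> topspace M \<Longrightarrow> smooth_in c V f"
  by (rule smooth_in_subset[of _ "topspace M"]) (auto simp: smooth_function_iff)

lemma smooth_vector_field_iff:
  "smooth_vector_field M \<A> X \<longleftrightarrow> (\<forall>p\<in>topspace M. X p \<in> tangent_space \<A> p) \<and>
    (\<forall>c\<in>\<A>. smooth_in c (topspace M) (\<lambda>p. X p c))"
  by (auto simp: smooth_vector_field_def smooth_in_topspace)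

lemma smooth_function_continuous:
  assumes f: "smooth_function \<A> f"
  shows "continuous_map M euclideanreal f"
  unfolding continuous_map_def
proof (intro conjI allI impI)
  fix U :: "real set"
  assume "openin euclideanreal U"
  then have U: "open U"
    by simp
  show "openin M {p \<in> topspace M. f p \<in> U}"
  proof (subst openin_subopen, intro ballI)
    fix p
    assume p: "p \<in> {p \<in> topspace M. f p \<in> U}"
    then obtain c where c: "c \<in> \<A>" "p \<in> chart_dom c"
      using chart_at by blast
    let ?S = "chart_img c \<inter> (\<lambda>x. f (chart_inv c x)) -` U"
    have "continuous_on (chart_img c) (\<lambda>x. f (chart_inv c x))"
      using f c(1) smooth_in_topspace[OF c(1), of f]
      by (intro smooth_on_imp_continuous_on) (auto simp: smooth_function_iff)
    then have "open ?S"
      using open_chart_img[OF c(1)] U by (rule continuous_open_preimage)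
    then have "openin M {q \<in> chart_dom c. chart_map c q \<in> ?S}"
      by (rule openin_chart_preimage[OF c(1)])
    moreover have "{q \<in> chart_dom c. chart_map c q \<in> ?S} \<subseteq> {p \<in> topspace M. f p \<in> U}"
      using chart_dom_subset[OF c(1)] by (auto simp: chart_inv_chart_map[OF c(1)])
    ultimately show "\<exists>T. openin M T \<and> p \<in> T \<and> T \<subseteq> {p \<in> topspace M. f p \<in> U}"
      using p c by (intro exI[of _ "{q \<in> chart_dom c. chart_map c q \<in> ?S}"])
        (auto simp: chart_inv_chart_map chart_map_in_img)
  qed
qed auto

text \<open>The chart domain of d and the complement of \<open>S\<close> are open and cover M.
  \<open>F\<close> is smooth on the first and 0 on the second; closedness of \<open>S\<close> makes
  the second open.\<close>

lemma smooth_in_extend_by_0: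
  fixes F :: "'a \<Rightarrow> 'b::real_normed_vector"
  assumes c: "c \<in> \<A>" and d: "d \<in> \<A>" and S: "closedin M S" "S \<subseteq> chart_dom d"
    and 0: "\<And>p. p \<in> topspace M - S \<Longrightarrow> F p = 0" and F: "smooth_in c (chart_dom d) F"
  shows "smooth_in c (topspace M) F"
proof (rule smooth_in_local[OF c])
  fix p
  assume p: "p \<in> topspace M" "p \<in> chart_dom c"
  show "\<exists>W. openin M W \<and> p \<in> W \<and> smooth_in c W F"
  proof (cases "p \<in> S")
    case True
    then show ?thesis
      using S F openin_chart_dom[OF d] by blast
  next
    case False
    have "openin M (topspace M - S)"
      using S by blast
    moreover from this have "smooth_in c (topspace M - S) F"
      using smooth_in_cong[OF c, of "topspace M - S" F "\<lambda>p. 0"] smooth_in_const[OF c] 0 by blast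
    ultimately show ?thesis
      using p False by blast
  qed
qed

lemma smooth_function_extend_by_0:
  assumes d: "d \<in> \<A>" and S: "closedin M S" "S \<subseteq> chart_dom d"
    and 0: "\<And>p. p \<in> topspace M - S \<Longrightarrow> f p = 0" and f: "smooth_in d (chart_dom d) f"
  shows "smooth_function \<A> f"
  unfolding smooth_function_iff
proof
  fix c
  assume c: "c \<in> \<A>"
  have "smooth_in c (chart_dom d) f"
    using smooth_in_change_chart[OF c d openin_chart_dom[OF d] f] by simp
  then show "smooth_in c (topspace M) f"
    using 0 by (intro smooth_in_extend_by_0[OF c d S]) auto
qed

lemma smooth_cutoff:
  assumes U: "openin M U" "p \<in> U"
  obtains c \<beta> S V where "c \<in> \<A>" "smooth_function \<A> \<beta>" "closedin M S" "S \<subseteq> chart_dom c \<inter> U"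
    "openin M V" "p \<in> V" "V \<subseteq> S" "\<forall>q\<in>V. \<beta> q = 1" "\<forall>q\<in>topspace M - S. \<beta> q = 0"
proof -
  have "p \<in> topspace M"
    using U openin_subset by blast
  then obtain c where c: "c \<in> \<A>" "p \<in> chart_dom c"
    using chart_at by blast
  let ?x = "chart_map c p"
  have "open (chart_map c ` (U \<inter> chart_dom c))" "?x \<in> chart_map c ` (U \<inter> chart_dom c)"
    using open_chart_image[OF c(1) U(1)] U c by auto
  then obtain \<rho> where \<rho>: "\<rho> > 0" "cball ?x \<rho> \<subseteq> chart_map c ` (U \<inter> chart_dom c)"
    by (meson open_contains_cball)
  define S where "S = chart_inv c ` cball ?x \<rho>"
  define V where "V = {q \<in> chart_dom c. chart_map c q \<in> ball ?x (\<rho> / 2)}"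
  \<comment> \<open>The argument of \<open>smooth_step\<close> is 4/3 (1 - t) with t the squared
    distance over \<rho>^2: it is at least 1 for t \<le> 1/4, that is on \<open>V\<close>, and at
    most 0 for t \<ge> 1. The squared distance is written in coordinates so that its smoothness is
    that of sums of products.\<close>
  define \<beta> where "\<beta> q = (if q \<in> chart_dom c then
      smooth_step (4 / 3 * (1 - (\<Sum>b\<in>B. ((chart_map c q \<bullet> b - ?x \<bullet> b) * (chart_map c q \<bullet> b - ?x \<bullet> b)) / \<rho>\<^sup>2))) else 0)"
    for q
  \<comment> \<open>Parseval's identity for the frame.\<close>
  have sum_eq: "(\<Sum>b\<in>B. ((x \<bullet> b - ?x \<bullet> b) * (x \<bullet> b - ?x \<bullet> b)) / \<rho>\<^sup>2) = (dist ?x x / \<rho>)\<^sup>2" for x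
  proof -
    have "(x - ?x) \<bullet> (x - ?x) = (\<Sum>b\<in>B. ((x - ?x) \<bullet> b) *\<^sub>R b) \<bullet> (x - ?x)"
      using frame by (simp add: is_frame_def)
    also have "\<dots> = (\<Sum>b\<in>B. (x \<bullet> b - ?x \<bullet> b) * (x \<bullet> b - ?x \<bullet> b))"
      unfolding inner_sum_left by (simp add: inner_commute[of _ "x - ?x"] inner_diff_left)
    finally show ?thesis
      by (simp add: sum_divide_distrib[symmetric] dist_norm power_divide power2_norm_eq_inner norm_minus_commute)
  qed
  have img: "cball ?x \<rho> \<subseteq> chart_img c"
    using \<rho>(2) by (auto simp: chart_img_def)
  \<comment> \<open>The Hausdorff property enters here: it makes the compact set \<open>S\<close>
    closed in M, so that \<beta> can be extended by 0.\<close>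
  have "compactin M S"
    unfolding S_def using c(1) compact_cball_frame[OF frame] img by (rule compactin_chart_inv_image)
  then have S: "closedin M S"
    using Hausdorff compactin_imp_closedin by blast
  have SU: "S \<subseteq> chart_dom c \<inter> U"
  proof
    fix q
    assume "q \<in> S"
    then obtain x where "q = chart_inv c x" "x \<in> cball ?x \<rho>"
      by (auto simp: S_def)
    then obtain r where "r \<in> U \<inter> chart_dom c" "q = chart_inv c (chart_map c r)"
      using \<rho>(2) by blast
    then show "q \<in> chart_dom c \<inter> U"
      using chart_inv_chart_map[OF c(1)] by auto
  qed
  have 0: "\<beta> q = 0" if q: "q \<in> topspace M - S" for q
  proof (cases "q \<in> chart_dom c")
    case True
    have "chart_map c q \<notin> cball ?x \<rho>"
    proof
      assume "chart_map c q \<in> cball ?x \<rho>"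
      then have "chart_inv c (chart_map c q) \<in> S"
        unfolding S_def by (rule imageI)
      then show False
        using q chart_inv_chart_map[OF c(1) True] by simp
    qed
    then have "1 \<le> dist ?x (chart_map c q) / \<rho>"
      using \<rho>(1) by simp
    then have "1 \<le> (dist ?x (chart_map c q) / \<rho>)\<^sup>2"
      by (rule one_le_power)
    then show ?thesis
      using True by (simp add: \<beta>_def sum_eq smooth_step_eq_0)
  qed (simp add: \<beta>_def)
  have 1: "\<beta> q = 1" if "q \<in> V" for q
  proof -
    have "dist ?x (chart_map c q) / \<rho> \<le> 1 / 2"
      using that \<rho>(1) by (simp add: V_def field_simps)
    then have "(dist ?x (chart_map c q) / \<rho>)\<^sup>2 \<le> (1 / 2)\<^sup>2"
      using \<rho>(1) by (intro power_mono) auto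
    moreover have "1 \<le> 4 / 3 * (1 - t)" if "t \<le> (1 / 2)\<^sup>2" for t :: real
      using that by (simp add: power2_eq_square)
    ultimately have "1 \<le> 4 / 3 * (1 - (dist ?x (chart_map c q) / \<rho>)\<^sup>2)"
      by blast
    from smooth_step_eq_1[OF this] show ?thesis
      using that by (simp add: \<beta>_def V_def sum_eq)
  qed
  have dom: "openin M (chart_dom c)"
    by (rule openin_chart_dom[OF c(1)])
  have "smooth_in c (chart_dom c) (\<lambda>q. smooth_step (4 / 3 *
      (1 - (\<Sum>b\<in>B. ((chart_map c q \<bullet> b - ?x \<bullet> b) * (chart_map c q \<bullet> b - ?x \<bullet> b)) / \<rho>\<^sup>2))))"
    using \<rho>(1)
    by (intro smooth_in_compose_real[OF c(1) dom _ smooth_on_smooth_step] smooth_in_mult[OF c(1) dom]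
        smooth_in_diff[OF c(1) dom] smooth_in_const[OF c(1) dom] smooth_in_sum[OF c(1) dom]
        smooth_in_divide[OF c(1) dom] smooth_in_inner_left[OF c(1) dom] smooth_in_chart_map[OF c(1) dom]) auto
  then have "smooth_in c (chart_dom c) \<beta>"
    by (subst smooth_in_cong[OF c(1) dom]) (auto simp: \<beta>_def)
  then have smooth: "smooth_function \<A> \<beta>"
    using SU 0 by (intro smooth_function_extend_by_0[OF c(1) S]) auto
  have V: "openin M V"
    unfolding V_def by (rule openin_chart_preimage[OF c(1) open_ball])
  have VS: "V \<subseteq> S"
  proof
    fix q
    assume "q \<in> V"
    then have "q = chart_inv c (chart_map c q)" "chart_map c q \<in> cball ?x \<rho>"
      using \<rho>(1) chart_inv_chart_map[OF c(1)] by (auto simp: V_def)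
    then show "q \<in> S"
      unfolding S_def by blast
  qed
  have pV: "p \<in> V"
    using c \<rho>(1) by (simp add: V_def)
  show thesis
    by (rule that[OF c(1) smooth S SU V pV VS]) (simp_all add: 1 0)
qed

section \<open>Coordinate vector fields\<close>

text \<open>The field with constant coordinates b in the chart d, carried to the other charts by the
  derivatives of the transition maps. Outside the domain of d it is 0, usually not smoothly across
  the boundary, so it is used globally only after multiplication by a bump.\<close>

definition coord_field :: "('a, 'e) chart \<Rightarrow> 'e \<Rightarrow> 'a \<Rightarrow> ('a, 'e) tangent_vector" where
  "coord_field d b p = (\<lambda>c. if c \<in> \<A> \<and> p \<in> chart_dom d \<inter> chart_dom c
     then frechet_derivative (transition d c) (at (chart_map d p)) b else 0)"

lemma transition_has_derivative:
  assumes "c \<in> \<A>" "d \<in> \<A>" "p \<in> chart_dom c" "p \<in> chart_dom d"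
  shows "(transition c d has_derivative frechet_derivative (transition c d) (at (chart_map c p)))
    (at (chart_map c p))"
  using assms by (intro smooth_on_has_derivative[OF smooth_transition]) auto

lemma tangent_space_transition:
  assumes "v \<in> tangent_space \<A> p" "c \<in> \<A>" "d \<in> \<A>" "p \<in> chart_dom c" "p \<in> chart_dom d"
  shows "v d = frechet_derivative (transition c d) (at (chart_map c p)) (v c)"
  using assms unfolding tangent_space_def by blast

lemma tangent_space_eq_0: "v \<in> tangent_space \<A> p \<Longrightarrow> c \<notin> \<A> \<or> p \<notin> chart_dom c \<Longrightarrow> v c = 0"
  unfolding tangent_space_def by blast

text \<open>The cocycle identity for the transitions d to c to c', differentiated by the chain
  rule.\<close>

lemma coord_field_in_tangent_space:
  assumes d: "d \<in> \<A>" "p \<in> chart_dom d"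
  shows "coord_field d b p \<in> tangent_space \<A> p"
proof -
  have "frechet_derivative (transition d c') (at (chart_map d p)) b =
      frechet_derivative (transition c c') (at (chart_map c p))
        (frechet_derivative (transition d c) (at (chart_map d p)) b)"
    if c: "c \<in> \<A>" "c' \<in> \<A>" "p \<in> chart_dom c \<inter> chart_dom c'" for c c'
  proof -
    let ?W = "chart_map d ` ((chart_dom c \<inter> chart_dom c') \<inter> chart_dom d)"
    have tr: "transition d c (chart_map d p) = chart_map c p"
      using d by (simp add: transition_def chart_inv_chart_map)
    have "((\<lambda>x. transition c c' (transition d c x)) has_derivative
        (\<lambda>v. frechet_derivative (transition c c') (at (chart_map c p))
          (frechet_derivative (transition d c) (at (chart_map d p)) v))) (at (chart_map d p))"
      using has_derivative_compose[OF transition_has_derivative[OF d(1) c(1) d(2), unfolded tr],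
          of "transition c c'"] transition_has_derivative[of c c' p] c tr by simp
    moreover have "open ?W"
      using c by (intro open_chart_image[OF d(1)] openin_Int openin_chart_dom) auto
    moreover have "chart_map d p \<in> ?W"
      using c d by auto
    moreover have "transition c c' (transition d c x) = transition d c' x" if "x \<in> ?W" for x
      using that d c by (auto simp: transition_def chart_inv_chart_map)
    ultimately have "(transition d c' has_derivative
        (\<lambda>v. frechet_derivative (transition c c') (at (chart_map c p))
          (frechet_derivative (transition d c) (at (chart_map d p)) v))) (at (chart_map d p))"
      by (rule has_derivative_transform_within_open)
    from fun_cong[OF frechet_derivative_at[OF this], of b] show ?thesis
      by (rule sym)
  qed
  note chain = this
  show ?thesis
    unfolding tangent_space_def
  proof (intro CollectI conjI allI ballI impI)
    fix c c'
    assume c: "c \<in> \<A>" "c' \<in> \<A>" "p \<in> chart_dom c \<inter> chart_dom c'"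
    show "coord_field d b p c' =
        frechet_derivative (transition c c') (at (chart_map c p)) (coord_field d b p c)"
      using chain[OF c] c d by (simp add: coord_field_def)
  qed (auto simp: coord_field_def)
qed

text \<open>Read in d, the c-component is a directional derivative of a transition map, hence
  smooth; a change of chart does the rest.\<close>

lemma smooth_in_coord_field:
  assumes c: "c \<in> \<A>" and d: "d \<in> \<A>"
  shows "smooth_in c (chart_dom d) (\<lambda>p. coord_field d b p c)"
proof -
  let ?S = "chart_map d ` (chart_dom c \<inter> chart_dom d)"
  have op: "openin M (chart_dom c)"
    by (rule openin_chart_dom[OF c])
  have "smooth_on ?S (\<lambda>x. frechet_derivative (transition d c) (at x) b)"
    by (rule smooth_on_frechet_derivative) (use smooth_transition[OF d c] in \<open>simp add: Int_commute\<close>)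
  then have "smooth_in d (chart_dom c) (\<lambda>p. coord_field d b p c)"
    unfolding smooth_in_def using c
    by (subst smooth_on_cong[OF open_chart_image[OF d op]]) (auto simp: coord_field_def chart_inv_chart_map[OF d])
  then have "smooth_in c (chart_dom c \<inter> chart_dom d) (\<lambda>p. coord_field d b p c)"
    by (rule smooth_in_change_chart[OF c d op])
  then show ?thesis
    by (rule smooth_in_subset) blast
qed

lemma coord_field_expansion:
  assumes d: "d \<in> \<A>" "p \<in> chart_dom d" and v: "v \<in> tangent_space \<A> p"
  shows "v c = (\<Sum>b\<in>B. (v d \<bullet> b) *\<^sub>R coord_field d b p c)"
proof (cases "c \<in> \<A> \<and> p \<in> chart_dom c")
  case True
  then have "v c = frechet_derivative (transition d c) (at (chart_map d p)) (v d)"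
    using tangent_space_transition[OF v d(1) _ d(2)] by blast
  also have "\<dots> = (\<Sum>b\<in>B. (v d \<bullet> b) *\<^sub>R frechet_derivative (transition d c) (at (chart_map d p)) b)"
    using True d by (intro linear_frame[OF frame] has_derivative_linear[OF transition_has_derivative]) auto
  finally show ?thesis
    using True d by (simp add: coord_field_def)
next
  case False
  then show ?thesis
    using tangent_space_eq_0[OF v, of c] by (auto simp: coord_field_def intro!: sum.neutral)
qed

lemma tangent_space_sum_scaleR:
  assumes "\<And>i. i \<in> I \<Longrightarrow> v i \<in> tangent_space \<A> p"
  shows "(\<lambda>c. \<Sum>i\<in>I. a i *\<^sub>R v i c) \<in> tangent_space \<A> p"
proof -
  have "(\<Sum>i\<in>I. a i *\<^sub>R v i d) = frechet_derivative (transition c d) (at (chart_map c p)) (\<Sum>i\<in>I. a i *\<^sub>R v i c)"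
    if cd: "c \<in> \<A>" "d \<in> \<A>" "p \<in> chart_dom c \<inter> chart_dom d" for c d
  proof -
    have "linear (frechet_derivative (transition c d) (at (chart_map c p)))"
      using cd by (intro has_derivative_linear[OF transition_has_derivative]) auto
    moreover have "v i d = frechet_derivative (transition c d) (at (chart_map c p)) (v i c)" if "i \<in> I" for i
      using tangent_space_transition[OF assms[OF that] cd(1,2)] cd(3) by blast
    ultimately show ?thesis
      by (simp add: linear_sum linear_scale)
  qed
  moreover have "(\<Sum>i\<in>I. a i *\<^sub>R v i c) = 0" if "c \<notin> \<A> \<or> p \<notin> chart_dom c" for c
    using tangent_space_eq_0[OF assms that] by simp
  ultimately show ?thesis
    unfolding tangent_space_def by blast
qed

end

section \<open>Local bump functions with a bounded number of colours\<close>

text \<open>For finite \<Phi> and s > 0 this says that p and q have sup-distance less than s. Stated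
  by a quantifier, it also makes sense for empty \<Phi>.\<close>

definition near :: "('a \<Rightarrow> real) set \<Rightarrow> real \<Rightarrow> 'a \<Rightarrow> 'a \<Rightarrow> bool" where
  "near \<Phi> s p q \<longleftrightarrow> (\<forall>f\<in>\<Phi>. \<bar>f p - f q\<bar> < s)"

lemma near_sym: "near \<Phi> s p q \<Longrightarrow> near \<Phi> s q p"
  by (simp add: near_def abs_minus_commute)

lemma near_refl: "s > 0 \<Longrightarrow> near \<Phi> s p p"
  by (simp add: near_def)

lemma near_mono: "near \<Phi> s p q \<Longrightarrow> s \<le> t \<Longrightarrow> near \<Phi> t p q"
  by (auto simp: near_def)

lemma near_trans: "near \<Phi> s p q \<Longrightarrow> near \<Phi> t q u \<Longrightarrow> near \<Phi> (s + t) p u"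
  unfolding near_def by (intro ballI) (smt (verit, best))

context framed_manifold
begin

lemma openin_near:
  assumes "finite \<Phi>" "\<And>f. f \<in> \<Phi> \<Longrightarrow> smooth_function \<A> f"
  shows "openin M {q \<in> topspace M. near \<Phi> s p q}"
proof -
  have iff: "\<bar>a - b\<bar> < s \<longleftrightarrow> b \<in> {a - s<..<a + s}" for a b :: real
    by auto
  have "openin M {q \<in> topspace M. f q \<in> {f p - s<..<f p + s}}" if "f \<in> \<Phi>" for f
    using smooth_function_continuous[OF assms(2)[OF that]] by (intro openin_continuous_map_preimage) auto
  then have "openin M (topspace M \<inter> (\<Inter>f\<in>\<Phi>. {q \<in> topspace M. f q \<in> {f p - s<..<f p + s}}))"
    using assms(1) by (cases "\<Phi> = {}") (auto intro!: openin_Int openin_INT2)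
  also have "topspace M \<inter> (\<Inter>f\<in>\<Phi>. {q \<in> topspace M. f q \<in> {f p - s<..<f p + s}}) =
      {q \<in> topspace M. near \<Phi> s p q}"
    by (auto simp: near_def iff)
  finally show ?thesis .
qed

section \<open>Functions that embed a neighbourhood of a compact set\<close>

text \<open>The point q ranges over all of M, so the functions must also tell p from far-away
  points; this plays the part of injectivity in an embedding.\<close>

definition detects_topology_at :: "('a \<Rightarrow> real) set \<Rightarrow> 'a \<Rightarrow> bool" where
  "detects_topology_at \<Phi> p \<longleftrightarrow>
     (\<forall>V. openin M V \<and> p \<in> V \<longrightarrow> (\<exists>s>0. \<forall>q\<in>topspace M. near \<Phi> s p q \<longrightarrow> q \<in> V))"

text \<open>Injectivity of the joint differential in quantitative form. The constant \<kappa> is not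
  uniform in p; it will influence radii but not the number of colours.\<close>

definition immersive_at :: "('a \<Rightarrow> real) set \<Rightarrow> 'a \<Rightarrow> bool" where
  "immersive_at \<Phi> p \<longleftrightarrow> (\<exists>c\<in>\<A>. p \<in> chart_dom c \<and> (\<exists>\<kappa>\<ge>0. \<forall>v. \<forall>e\<ge>0.
     (\<forall>f\<in>\<Phi>. \<bar>frechet_derivative (\<lambda>x. f (chart_inv c x)) (at (chart_map c p)) v\<bar> \<le> e) \<longrightarrow> norm v \<le> \<kappa> * e))"

lemma compactin_finite_subcover:
  assumes "compactin M A" "\<And>p. p \<in> A \<Longrightarrow> openin M (V p) \<and> p \<in> V p"
  obtains D where "finite D" "D \<subseteq> A" "A \<subseteq> (\<Union>p\<in>D. V p)"
proof -
  have "\<exists>\<F>. finite \<F> \<and> \<F> \<subseteq> V ` A \<and> A \<subseteq> \<Union> \<F>"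
    using assms by (intro compactinD[OF assms(1)]) auto
  then obtain \<F> where \<F>: "finite \<F>" "\<F> \<subseteq> V ` A" "A \<subseteq> \<Union> \<F>"
    by blast
  obtain D where "D \<subseteq> A" "finite D" "\<F> = V ` D"
    using finite_subset_image[OF \<F>(1,2)] by blast
  with \<F>(3) that show thesis
    by blast
qed

text \<open>The cut-off \<beta> itself belongs to the family: \<beta> q close to 1 forces q into the
  chart. The products \<beta> * x_b alone vanish outside \<open>S\<close>, so they could not tell
  such points from the one with coordinates 0.\<close>

lemma cutoff_coordinates:
  assumes c: "c \<in> \<A>" and \<beta>: "smooth_function \<A> \<beta>" and S: "closedin M S" "S \<subseteq> chart_dom c"
    and V: "openin M V" "V \<subseteq> S" "\<And>q. q \<in> V \<Longrightarrow> \<beta> q = 1" and 0: "\<And>q. q \<in> topspace M - S \<Longrightarrow> \<beta> q = 0"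
  defines "\<Psi> \<equiv> insert \<beta> ((\<lambda>b q. \<beta> q * (chart_map c q \<bullet> b)) ` B)"
  shows "finite \<Psi>" "\<And>f. f \<in> \<Psi> \<Longrightarrow> smooth_function \<A> f"
    and "\<And>p. p \<in> V \<Longrightarrow> detects_topology_at \<Psi> p" "\<And>p. p \<in> V \<Longrightarrow> immersive_at \<Psi> p"
proof -
  show "finite \<Psi>"
    using frame by (simp add: \<Psi>_def is_frame_def)
  have dom: "openin M (chart_dom c)"
    by (rule openin_chart_dom[OF c])
  have "smooth_function \<A> (\<lambda>q. \<beta> q * (chart_map c q \<bullet> b))" for b
  proof (rule smooth_function_extend_by_0[OF c S])
    show "smooth_in c (chart_dom c) (\<lambda>q. \<beta> q * (chart_map c q \<bullet> b))"
      by (intro smooth_in_mult[OF c dom] smooth_in_inner_left[OF c dom] smooth_in_chart_map[OF c dom]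
          smooth_functionD[OF \<beta> c chart_dom_subset[OF c]])
  qed (simp add: 0)
  then show "smooth_function \<A> f" if "f \<in> \<Psi>" for f
    using that \<beta> by (auto simp: \<Psi>_def)
  fix p
  assume p: "p \<in> V"
  have pdom: "p \<in> chart_dom c"
    using p V(2) S(2) by blast
  let ?x = "chart_map c p"
  show "detects_topology_at \<Psi> p"
    unfolding detects_topology_at_def
  proof (intro allI impI)
    fix W
    assume W: "openin M W \<and> p \<in> W"
    then have "open (chart_map c ` (W \<inter> chart_dom c))" "?x \<in> chart_map c ` (W \<inter> chart_dom c)"
      using open_chart_image[OF c] pdom by auto
    then obtain \<epsilon> where \<epsilon>: "\<epsilon> > 0" "ball ?x \<epsilon> \<subseteq> chart_map c ` (W \<inter> chart_dom c)"
      by (meson open_contains_ball)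
    \<comment> \<open>The bound s \<le> 1/2 gives \<beta> q > 1/2, hence q in the chart. The
      coordinate b is then controlled up to 2 s (1 + |x_b|), the 2 coming from division by \<beta>
      q, and \<open>L\<close> collects these errors so that 2 s L < \<epsilon>.\<close>
    define L where "L = (\<Sum>b\<in>B. (1 + \<bar>?x \<bullet> b\<bar>) * norm b)"
    define s where "s = min (1 / 2) (\<epsilon> / (2 * (L + 1)))"
    have L: "L \<ge> 0"
      unfolding L_def by (intro sum_nonneg) auto
    have s: "s > 0" "s \<le> 1 / 2"
      unfolding s_def using \<epsilon>(1) L by (simp, intro min.cobounded1)
    have "s \<le> \<epsilon> / (2 * (L + 1))"
      by (simp add: s_def)
    then have "s * (2 * (L + 1)) \<le> \<epsilon>"
      using L by (simp add: pos_le_divide_eq)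
    then have sL: "2 * s * L < \<epsilon>"
      using s(1) by (simp add: algebra_simps)
    have "q \<in> W" if q: "q \<in> topspace M" "near \<Psi> s p q" for q
    proof -
      have \<beta>q: "\<bar>1 - \<beta> q\<bar> < s"
        using q(2) V(3)[OF p] by (auto simp: near_def \<Psi>_def)
      then have "\<beta> q > 1 / 2"
        using s(2) by linarith
      then have qdom: "q \<in> chart_dom c"
        using 0[of q] q(1) S(2) by force
      let ?y = "chart_map c q"
      have "\<bar>(?y - ?x) \<bullet> b\<bar> \<le> 2 * s * (1 + \<bar>?x \<bullet> b\<bar>)" if "b \<in> B" for b
      proof -
        have "\<bar>?x \<bullet> b - \<beta> q * (?y \<bullet> b)\<bar> < s"
          using q(2) V(3)[OF p] that by (auto simp: near_def \<Psi>_def)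
        moreover have "\<bar>(1 - \<beta> q) * (?x \<bullet> b)\<bar> \<le> s * \<bar>?x \<bullet> b\<bar>"
          using \<beta>q by (simp add: abs_mult mult_right_mono)
        moreover have "\<beta> q * ((?y - ?x) \<bullet> b) = (1 - \<beta> q) * (?x \<bullet> b) - (?x \<bullet> b - \<beta> q * (?y \<bullet> b))"
          by (simp add: inner_diff_left algebra_simps)
        ultimately have "\<bar>\<beta> q * ((?y - ?x) \<bullet> b)\<bar> \<le> s + s * \<bar>?x \<bullet> b\<bar>"
          by linarith
        moreover have "1 / 2 * \<bar>(?y - ?x) \<bullet> b\<bar> \<le> \<bar>\<beta> q * ((?y - ?x) \<bullet> b)\<bar>"
          unfolding abs_mult using \<open>\<beta> q > 1 / 2\<close> by (intro mult_right_mono) auto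
        ultimately show ?thesis
          by (simp add: algebra_simps)
      qed
      then have "(\<Sum>b\<in>B. \<bar>(?y - ?x) \<bullet> b\<bar> * norm b) \<le> (\<Sum>b\<in>B. (2 * s * (1 + \<bar>?x \<bullet> b\<bar>)) * norm b)"
        by (intro sum_mono mult_right_mono) auto
      also have "\<dots> = 2 * s * L"
        by (simp add: L_def sum_distrib_left mult_ac)
      finally have "?y \<in> ball ?x \<epsilon>"
        using is_frame_norm_le[OF frame, of "?y - ?x"] sL by (simp add: dist_norm norm_minus_commute)
      then obtain r where "r \<in> W" "r \<in> chart_dom c" "?y = chart_map c r"
        using \<epsilon>(2) by blast
      then show "q \<in> W"
        using inj_onD[OF inj_on_chart[OF c] _ qdom] by auto
    qed
    with s(1) show "\<exists>s>0. \<forall>q\<in>topspace M. near \<Psi> s p q \<longrightarrow> q \<in> W"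
      by blast
  qed
  \<comment> \<open>Since \<beta> is 1 on \<open>V\<close>, the products are plain coordinates near
    \<open>?x\<close>, and their differentials are the coordinate functionals.\<close>
  have der: "frechet_derivative (\<lambda>x. \<beta> (chart_inv c x) * (chart_map c (chart_inv c x) \<bullet> b)) (at ?x) v = v \<bullet> b" for b v
  proof -
    have "frechet_derivative (\<lambda>x. \<beta> (chart_inv c x) * (chart_map c (chart_inv c x) \<bullet> b)) (at ?x) =
        frechet_derivative (\<lambda>x. x \<bullet> b) (at ?x)"
      using p pdom open_chart_image[OF c V(1)]
      by (intro frechet_derivative_cong_open[of "chart_map c ` (V \<inter> chart_dom c)"])
        (auto simp: chart_inv_chart_map[OF c] V(3))
    also have "\<dots> = (\<lambda>v. v \<bullet> b)"
      by (rule frechet_derivative_at[symmetric])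
        (rule bounded_linear_imp_has_derivative[OF bounded_linear_inner_left])
    finally show ?thesis
      by simp
  qed
  have "norm v \<le> (\<Sum>b\<in>B. norm b) * e"
    if "\<forall>f\<in>\<Psi>. \<bar>frechet_derivative (\<lambda>x. f (chart_inv c x)) (at ?x) v\<bar> \<le> e" for v e
  proof -
    have "\<bar>v \<bullet> b\<bar> \<le> e" if "b \<in> B" for b
      using \<open>\<forall>f\<in>\<Psi>. _\<close>[rule_format, of "\<lambda>q. \<beta> q * (chart_map c q \<bullet> b)"] that der[of b v]
      by (simp add: \<Psi>_def)
    then have "(\<Sum>b\<in>B. \<bar>v \<bullet> b\<bar> * norm b) \<le> (\<Sum>b\<in>B. e * norm b)"
      by (intro sum_mono mult_right_mono) auto
    then show ?thesis
      using is_frame_norm_le[OF frame, of v] by (simp add: sum_distrib_left mult.commute)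
  qed
  then show "immersive_at \<Psi> p"
    unfolding immersive_at_def using c pdom
    by (intro bexI[of _ c] conjI exI[of _ "\<Sum>b\<in>B. norm b"]) (auto intro: sum_nonneg)
qed

lemma detects_topology_at_mono:
  "detects_topology_at \<Psi> p \<Longrightarrow> \<Psi> \<subseteq> \<Phi> \<Longrightarrow> detects_topology_at \<Phi> p"
  unfolding detects_topology_at_def near_def by (meson subsetD)

lemma immersive_at_mono: "immersive_at \<Psi> p \<Longrightarrow> \<Psi> \<subseteq> \<Phi> \<Longrightarrow> immersive_at \<Phi> p"
  unfolding immersive_at_def by (meson subsetD)

text \<open>Both properties survive enlarging the family, so the union over a finite subcover works
  at every point of \<open>A\<close>.\<close>

lemma compact_embedding_functions:
  assumes A: "compactin M A"
  obtains \<Phi> where "finite \<Phi>" "\<forall>f\<in>\<Phi>. smooth_function \<A> f"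
    "\<forall>p\<in>A. detects_topology_at \<Phi> p" "\<forall>p\<in>A. immersive_at \<Phi> p"
proof -
  have "\<exists>V \<Psi>. openin M V \<and> p \<in> V \<and> finite \<Psi> \<and> (\<forall>f\<in>\<Psi>. smooth_function \<A> f) \<and>
      (\<forall>q\<in>V. detects_topology_at \<Psi> q \<and> immersive_at \<Psi> q)" if p: "p \<in> A" for p
  proof -
    have pM: "p \<in> topspace M"
      using p A compactin_subset_topspace by blast
    obtain c \<beta> S V where *: "c \<in> \<A>" "smooth_function \<A> \<beta>" "closedin M S"
      "S \<subseteq> chart_dom c \<inter> topspace M" "openin M V" "p \<in> V" "V \<subseteq> S"
      "\<forall>q\<in>V. \<beta> q = 1" "\<forall>q\<in>topspace M - S. \<beta> q = 0"
      by (rule smooth_cutoff[OF openin_topspace pM])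
    have "S \<subseteq> chart_dom c"
      using *(4) by blast
    note cutoff_coordinates[OF *(1,2,3) this *(5,7) *(8,9)[rule_format]]
    with *(5,6) show ?thesis
      by blast
  qed
  then obtain V \<Psi> where V: "\<And>p. p \<in> A \<Longrightarrow> openin M (V p) \<and> p \<in> V p"
    and \<Psi>: "\<And>p. p \<in> A \<Longrightarrow> finite (\<Psi> p) \<and> (\<forall>f\<in>\<Psi> p. smooth_function \<A> f) \<and>
      (\<forall>q\<in>V p. detects_topology_at (\<Psi> p) q \<and> immersive_at (\<Psi> p) q)"
    by metis
  obtain D where D: "finite D" "D \<subseteq> A" "A \<subseteq> (\<Union>p\<in>D. V p)"
    using compactin_finite_subcover[OF A V] .
  have "detects_topology_at (\<Union>p\<in>D. \<Psi> p) q" "immersive_at (\<Union>p\<in>D. \<Psi> p) q" if q: "q \<in> A" for q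
  proof -
    obtain p where p: "p \<in> D" "q \<in> V p"
      using D(3) q by blast
    then have "detects_topology_at (\<Psi> p) q" "immersive_at (\<Psi> p) q" "\<Psi> p \<subseteq> (\<Union>p\<in>D. \<Psi> p)"
      using D(2) \<Psi> by auto
    then show "detects_topology_at (\<Union>p\<in>D. \<Psi> p) q" "immersive_at (\<Union>p\<in>D. \<Psi> p) q"
      using detects_topology_at_mono immersive_at_mono by metis+
  qed
  moreover have "finite (\<Union>p\<in>D. \<Psi> p)" "\<forall>f\<in>(\<Union>p\<in>D. \<Psi> p). smooth_function \<A> f"
    using D \<Psi> by auto
  ultimately show thesis
    using that[of "\<Union>p\<in>D. \<Psi> p"] by blast
qed

text \<open>
  Near each point, \<open>card B\<close> of the functions in \<open>\<Phi>\<close> are bi-Lipschitz coordinates for the sup-distance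
  defined by all of \<open>\<Phi>\<close>, with a Lipschitz constant that depends on \<open>card B\<close> only.
\<close>

definition few_control :: "('a \<Rightarrow> real) set \<Rightarrow> real \<Rightarrow> 'a \<Rightarrow> bool" where
  "few_control \<Phi> s p \<longleftrightarrow> (\<exists>J\<subseteq>\<Phi>. card J \<le> card B \<and>
     (\<forall>q\<in>topspace M. \<forall>q'\<in>topspace M. near \<Phi> s p q \<longrightarrow> near \<Phi> s p q' \<longrightarrow>
       (\<forall>e\<ge>0. (\<forall>f\<in>J. \<bar>f q - f q'\<bar> \<le> e) \<longrightarrow> (\<forall>f\<in>\<Phi>. \<bar>f q - f q'\<bar> \<le> 3 ^ Suc (card B) * e))))"

text \<open>\<open>controlling_functionals\<close> selects \<open>J\<close> for the differentials at
  p, and strict differentiability carries the estimate over to the functions. Writing v for the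
  coordinate difference, the linearisation error is absorbed: \<bar>f q - f q'\<bar> \<le> C * 2e +
  e \<le> 3 C e with C = 3^(card B), which explains the exponent
  \<open>Suc (card B)\<close>.\<close>

lemma few_control:
  assumes \<Phi>: "finite \<Phi>" "\<And>f. f \<in> \<Phi> \<Longrightarrow> smooth_function \<A> f"
    and det: "detects_topology_at \<Phi> p" and imm: "immersive_at \<Phi> p"
  shows "\<exists>s>0. few_control \<Phi> s p"
proof -
  obtain c \<kappa> where c: "c \<in> \<A>" "p \<in> chart_dom c" and \<kappa>: "\<kappa> \<ge> 0" and
    imm: "\<And>v e. e \<ge> 0 \<Longrightarrow> (\<forall>f\<in>\<Phi>. \<bar>frechet_derivative (\<lambda>x. f (chart_inv c x)) (at (chart_map c p)) v\<bar> \<le> e)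
      \<Longrightarrow> norm v \<le> \<kappa> * e"
    using imm unfolding immersive_at_def by metis
  let ?x = "chart_map c p"
  define L where "L f = frechet_derivative (\<lambda>x. f (chart_inv c x)) (at ?x)" for f :: "'a \<Rightarrow> real"
  have sm: "smooth_on (chart_img c) (\<lambda>x. f (chart_inv c x))" if "f \<in> \<Phi>" for f
    using smooth_functionD[OF \<Phi>(2)[OF that] c(1) order_refl] smooth_in_topspace[OF c(1)] by blast
  have x: "?x \<in> chart_img c"
    by (rule chart_map_in_img[OF c(2)])
  have lin: "linear (L f)" if "f \<in> \<Phi>" for f
    unfolding L_def by (rule has_derivative_linear[OF smooth_on_has_derivative[OF sm[OF that] x]])
  define C :: real where "C = 3 ^ card B"
  have C: "C \<ge> 1"
    by (simp add: C_def)
  obtain J where J: "J \<subseteq> \<Phi>" "card J \<le> card B" and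
    JL: "\<And>v e. e \<ge> 0 \<Longrightarrow> (\<forall>j\<in>J. \<bar>L j v\<bar> \<le> e) \<Longrightarrow> (\<forall>f\<in>\<Phi>. \<bar>L f v\<bar> \<le> C * e)"
    using controlling_functionals[of \<Phi> L B "card B", OF \<Phi>(1) lin] frame is_frame_span[OF frame]
    unfolding is_frame_def C_def by auto
  \<comment> \<open>Chosen so that \<kappa> C \<epsilon> \<le> 1/2. The immersion constant thus
    shrinks the radius s but leaves the factor C untouched.\<close>
  define \<epsilon> where "\<epsilon> = 1 / (2 * (\<kappa> * C + 1))"
  have "\<kappa> * C \<ge> 0"
    using \<kappa> C by simp
  then have \<epsilon>: "\<epsilon> > 0" and \<epsilon>C: "2 * (\<kappa> * C * \<epsilon>) \<le> 1"
    by (auto simp: \<epsilon>_def field_simps)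
  have "\<exists>\<delta>>0. \<forall>y\<in>ball ?x \<delta>. \<forall>z\<in>ball ?x \<delta>.
      \<bar>f (chart_inv c y) - f (chart_inv c z) - L f (y - z)\<bar> \<le> \<epsilon> * norm (y - z)" if "f \<in> \<Phi>" for f
    using smooth_on_strict_differentiable[OF frame open_chart_img[OF c(1)] x sm[OF that] \<epsilon>]
    unfolding L_def by blast
  then obtain \<delta> where \<delta>: "\<And>f. f \<in> \<Phi> \<Longrightarrow> \<delta> f > 0" and
    strict: "\<And>f y z. f \<in> \<Phi> \<Longrightarrow> y \<in> ball ?x (\<delta> f) \<Longrightarrow> z \<in> ball ?x (\<delta> f) \<Longrightarrow>
      \<bar>f (chart_inv c y) - f (chart_inv c z) - L f (y - z)\<bar> \<le> \<epsilon> * norm (y - z)"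
    by metis
  define d where "d = Min (insert 1 (\<delta> ` \<Phi>))"
  have d: "d > 0" "\<And>f. f \<in> \<Phi> \<Longrightarrow> d \<le> \<delta> f"
    using \<Phi>(1) \<delta> by (auto simp: d_def)
  \<comment> \<open>Detection of the topology turns closeness in \<Phi> into closeness in the chart,
    where the linearisation is valid.\<close>
  obtain s where s: "s > 0" "\<And>q. q \<in> topspace M \<Longrightarrow> near \<Phi> s p q \<Longrightarrow>
      q \<in> {q \<in> chart_dom c. chart_map c q \<in> ball ?x d}"
    using det[unfolded detects_topology_at_def, rule_format, of "{q \<in> chart_dom c. chart_map c q \<in> ball ?x d}"]
      openin_chart_preimage[OF c(1) open_ball] c(2) d(1) by auto
  have "\<bar>f q - f q'\<bar> \<le> 3 ^ Suc (card B) * e"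
    if q: "q \<in> topspace M" "q' \<in> topspace M" "near \<Phi> s p q" "near \<Phi> s p q'"
      and e: "e \<ge> 0" "\<forall>j\<in>J. \<bar>j q - j q'\<bar> \<le> e" and f: "f \<in> \<Phi>" for q q' e f
  proof -
    define v where "v = chart_map c q - chart_map c q'"
    have str: "\<bar>g q - g q' - L g v\<bar> \<le> \<epsilon> * norm v" if "g \<in> \<Phi>" for g
      using strict[OF that, of "chart_map c q" "chart_map c q'"] s(2)[OF q(1,3)] s(2)[OF q(2,4)] d(2)[OF that]
      by (simp add: v_def chart_inv_chart_map[OF c(1)])
    have pos: "e + \<epsilon> * norm v \<ge> 0"
      using e(1) \<epsilon> by simp
    have "\<bar>L j v\<bar> \<le> e + \<epsilon> * norm v" if "j \<in> J" for j
      using str[of j] e(2)[rule_format, OF that] J(1) that by fastforce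
    then have LL: "\<bar>L f v\<bar> \<le> C * (e + \<epsilon> * norm v)" if "f \<in> \<Phi>" for f
      using JL[OF pos] that by blast
    \<comment> \<open>The norm of v occurs on both sides; by the choice of \<epsilon> half of it can
      be absorbed on the left. The outcome is \<epsilon> * norm v \<le> e.\<close>
    have "norm v \<le> \<kappa> * (C * (e + \<epsilon> * norm v))"
      using LL pos C by (intro imm) (auto simp: L_def)
    also have "\<dots> = \<kappa> * C * e + (\<kappa> * C * \<epsilon>) * norm v"
      by (simp add: algebra_simps)
    also have "\<dots> \<le> \<kappa> * C * e + 1 / 2 * norm v"
      using \<epsilon>C by (intro add_left_mono mult_right_mono) auto
    finally have "norm v \<le> 2 * (\<kappa> * C * e)"
      by simp
    then have "\<epsilon> * norm v \<le> \<epsilon> * (2 * (\<kappa> * C * e))"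
      using \<epsilon> by (intro mult_left_mono) auto
    also have "\<dots> = 2 * (\<kappa> * C * \<epsilon>) * e"
      by (simp add: algebra_simps)
    also have "\<dots> \<le> 1 * e"
      using \<epsilon>C e(1) by (intro mult_right_mono) auto
    finally have ev: "\<epsilon> * norm v \<le> e"
      by simp
    then have "C * (e + \<epsilon> * norm v) \<le> C * (2 * e)"
      using C by (intro mult_left_mono) auto
    moreover have "1 * e \<le> C * e"
      using C e(1) by (intro mult_right_mono) auto
    moreover have "3 ^ Suc (card B) * e = C * (2 * e) + C * e"
      by (simp add: C_def)
    ultimately show ?thesis
      using str[OF f] LL[OF f] ev by linarith
  qed
  then have "few_control \<Phi> s p"
    unfolding few_control_def using J by blast
  with s(1) show ?thesis
    by blast
qed

section \<open>Separated bumps on a compact set\<close>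

text \<open>Each bump carries a chart and a closed set \<open>S i\<close> containing its support, in
  the form needed for extension by 0.\<close>

definition bump_family ::
    "'a set \<Rightarrow> 'i set \<Rightarrow> ('i \<Rightarrow> 'a \<Rightarrow> real) \<Rightarrow> ('i \<Rightarrow> ('a, 'e) chart) \<Rightarrow> ('i \<Rightarrow> 'a set) \<Rightarrow> bool" where
  "bump_family U I \<psi> ch S \<longleftrightarrow> (\<forall>i\<in>I. smooth_function \<A> (\<psi> i) \<and> ch i \<in> \<A> \<and> closedin M (S i) \<and>
     S i \<subseteq> chart_dom (ch i) \<inter> U \<and> (\<forall>q\<in>topspace M - S i. \<psi> i q = 0))"

definition proper_colouring :: "'i set \<Rightarrow> ('i \<Rightarrow> 'a \<Rightarrow> real) \<Rightarrow> ('i \<Rightarrow> nat) \<Rightarrow> nat \<Rightarrow> bool" where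
  "proper_colouring I \<psi> col N \<longleftrightarrow> (\<forall>i\<in>I. col i < N) \<and>
     (\<forall>i\<in>I. \<forall>j\<in>I. i \<noteq> j \<and> col i = col j \<longrightarrow> (\<forall>q\<in>topspace M. \<psi> i q = 0 \<or> \<psi> j q = 0))"

text \<open>A Lebesgue number argument for the sup-distance: finitely many balls of half the
  admissible radius cover \<open>A\<close>, and the triangle inequality passes the property from
  their centres to all points of \<open>A\<close>.\<close>

lemma uniform_scale:
  assumes A: "compactin M A" and U: "openin M U" "A \<subseteq> U"
    and \<Phi>: "finite \<Phi>" "\<And>f. f \<in> \<Phi> \<Longrightarrow> smooth_function \<A> f"
    "\<And>p. p \<in> A \<Longrightarrow> detects_topology_at \<Phi> p" "\<And>p. p \<in> A \<Longrightarrow> immersive_at \<Phi> p"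
  obtains r where "r > 0" "\<And>p. p \<in> A \<Longrightarrow> few_control \<Phi> r p"
    "\<And>p. p \<in> A \<Longrightarrow> \<exists>c\<in>\<A>. \<exists>S. closedin M S \<and> S \<subseteq> chart_dom c \<inter> U \<and>
      (\<forall>q\<in>topspace M. near \<Phi> r p q \<longrightarrow> q \<in> S)"
proof -
  define good where "good s p \<longleftrightarrow> few_control \<Phi> s p \<and> (\<exists>c\<in>\<A>. \<exists>S. closedin M S \<and> S \<subseteq> chart_dom c \<inter> U \<and>
      (\<forall>q\<in>topspace M. near \<Phi> s p q \<longrightarrow> q \<in> S))" for s p
  have goodI: "good t p" if "good s p'" "\<And>q. near \<Phi> t p q \<Longrightarrow> near \<Phi> s p' q" for s t p p'
  proof -
    have "few_control \<Phi> t p"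
      using that unfolding good_def few_control_def by meson
    then show ?thesis
      using that unfolding good_def by meson
  qed
  have "\<exists>s>0. good s p" if p: "p \<in> A" for p
  proof -
    obtain s1 where s1: "s1 > 0" "few_control \<Phi> s1 p"
      using few_control[OF \<Phi>(1,2) \<Phi>(3)[OF p] \<Phi>(4)[OF p]] by blast
    have pU: "p \<in> U"
      using p U by blast
    obtain c \<beta> S V where c: "c \<in> \<A>" "smooth_function \<A> \<beta>" "closedin M S" "S \<subseteq> chart_dom c \<inter> U"
      "openin M V" "p \<in> V" "V \<subseteq> S" "\<forall>q\<in>V. \<beta> q = 1" "\<forall>q\<in>topspace M - S. \<beta> q = 0"
      by (rule smooth_cutoff[OF U(1) pU])
    obtain s2 where s2: "s2 > 0" "\<And>q. q \<in> topspace M \<Longrightarrow> near \<Phi> s2 p q \<Longrightarrow> q \<in> V"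
      using \<Phi>(3)[OF p] c(5,6) unfolding detects_topology_at_def by metis
    have "few_control \<Phi> (min s1 s2) p"
      using s1(2) near_mono[of \<Phi> "min s1 s2" p _ s1] unfolding few_control_def by (meson min.cobounded1)
    moreover have "q \<in> S" if "q \<in> topspace M" "near \<Phi> (min s1 s2) p q" for q
      using s2(2)[OF that(1) near_mono[OF that(2)]] c(7) by auto
    ultimately have "good (min s1 s2) p"
      unfolding good_def using c(1,3,4) by blast
    then show ?thesis
      using s1(1) s2(1) by (intro exI[of _ "min s1 s2"]) auto
  qed
  then obtain s where s: "\<And>p. p \<in> A \<Longrightarrow> s p > 0" "\<And>p. p \<in> A \<Longrightarrow> good (s p) p"
    by metis
  have "openin M {q \<in> topspace M. near \<Phi> (s p / 2) p q} \<and> p \<in> {q \<in> topspace M. near \<Phi> (s p / 2) p q}"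
    if "p \<in> A" for p
    using openin_near[OF \<Phi>(1,2)] near_refl[of "s p / 2"] s(1)[OF that] that compactin_subset_topspace[OF A] by auto
  from compactin_finite_subcover[OF A this]
  obtain D where D: "finite D" "D \<subseteq> A" "A \<subseteq> (\<Union>p\<in>D. {q \<in> topspace M. near \<Phi> (s p / 2) p q})" .
  define r where "r = Min (insert 1 ((\<lambda>p. s p / 2) ` D))"
  have r: "r > 0"
    using D(1,2) s(1) by (auto simp: r_def)
  have r_le: "r \<le> s p / 2" if "p \<in> D" for p
    unfolding r_def using D(1) that by (intro Min_le) auto
  have "good r p" if p: "p \<in> A" for p
  proof -
    obtain p' where p': "p' \<in> D" "near \<Phi> (s p' / 2) p' p"
      using D(3) p by blast
    have "near \<Phi> (s p') p' q" if "near \<Phi> r p q" for q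
      using near_trans[OF p'(2) near_mono[OF that r_le[OF p'(1)]]] by simp
    then show ?thesis
      using goodI s(2) p'(1) D(2) by blast
  qed
  then show thesis
    using that[OF r] unfolding good_def by blast
qed

text \<open>The bumps have radius 2r around r-separated centres. Two of them can be nonzero at a
  common point only if their centres are less than 4r = \<open>r4\<close> apart, which is the scale
  on which \<open>few_control\<close> holds. The number of colours is one more than the packing
  bound.\<close>

lemma coloured_bumps_on_compact:
  assumes A: "compactin M A" and U: "openin M U" "A \<subseteq> U"
  shows "\<exists>P \<psi> ch S col. finite P \<and> bump_family U P \<psi> ch S \<and>
    proper_colouring P \<psi> col (Suc ((16 * 3 ^ Suc (card B)) ^ card B)) \<and>
    (\<forall>q\<in>A. \<exists>p\<in>P. \<psi> (p::'a) q \<noteq> 0)"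
proof -
  obtain \<Phi> where \<Phi>: "finite \<Phi>" "\<forall>f\<in>\<Phi>. smooth_function \<A> f"
    "\<forall>p\<in>A. detects_topology_at \<Phi> p" "\<forall>p\<in>A. immersive_at \<Phi> p"
    using compact_embedding_functions[OF A] .
  note \<Phi> = \<Phi>(1) \<Phi>(2-4)[rule_format]
  obtain r4 where r4: "r4 > 0" and ctrl4: "\<And>p. p \<in> A \<Longrightarrow> few_control \<Phi> r4 p"
    and small4: "\<And>p. p \<in> A \<Longrightarrow> \<exists>c\<in>\<A>. \<exists>S. closedin M S \<and> S \<subseteq> chart_dom c \<inter> U \<and>
      (\<forall>q\<in>topspace M. near \<Phi> r4 p q \<longrightarrow> q \<in> S)"
    using uniform_scale[OF A U \<Phi>] by blast
  define r where "r = r4 / 4"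
  have r: "r > 0" and r4_eq: "r4 = 4 * r"
    using r4 by (auto simp: r_def)
  have AM: "A \<subseteq> topspace M"
    using A compactin_subset_topspace by blast
  have "openin M {q \<in> topspace M. near \<Phi> r p q} \<and> p \<in> {q \<in> topspace M. near \<Phi> r p q}" if "p \<in> A" for p
    using openin_near[OF \<Phi>(1,2)] near_refl[OF r] that AM by auto
  from compactin_finite_subcover[OF A this]
  obtain Z where Z: "finite Z" "Z \<subseteq> A" "A \<subseteq> (\<Union>p\<in>Z. {q \<in> topspace M. near \<Phi> r p q})" .
  \<comment> \<open>Centres are sought inside the finite net \<open>Z\<close>, so that a maximal
    separated set exists. A point of \<open>A\<close> is within r of the net and a net point within
    r of a centre, which gives covering radius 2r.\<close>
  define sep where "sep P \<longleftrightarrow> (\<forall>p\<in>P. \<forall>q\<in>P. p \<noteq> q \<longrightarrow> \<not> near \<Phi> r p q)" for P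
  have "finite {P. P \<subseteq> Z \<and> sep P}" "{} \<in> {P. P \<subseteq> Z \<and> sep P}"
    using Z(1) by (auto simp: sep_def)
  then have "\<exists>P\<in>{P. P \<subseteq> Z \<and> sep P}. \<forall>Q\<in>{P. P \<subseteq> Z \<and> sep P}. P \<subseteq> Q \<longrightarrow> P = Q"
    by (intro finite_has_maximal) auto
  then obtain P where P: "P \<subseteq> Z" "sep P" and maxP: "\<And>Q. Q \<subseteq> Z \<Longrightarrow> sep Q \<Longrightarrow> P \<subseteq> Q \<Longrightarrow> P = Q"
    by (elim bexE CollectE conjE) simp
  have PA: "P \<subseteq> A" and finP: "finite P"
    using P(1) Z finite_subset by auto
  have cover: "\<exists>p\<in>P. near \<Phi> (2 * r) p q" if q: "q \<in> A" for q
  proof -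
    obtain z where z: "z \<in> Z" "near \<Phi> r z q"
      using subsetD[OF Z(3) q] by auto
    have "\<exists>p\<in>P. near \<Phi> r p z"
    proof (rule ccontr)
      assume no: "\<not> (\<exists>p\<in>P. near \<Phi> r p z)"
      then have "\<not> near \<Phi> r p z" "\<not> near \<Phi> r z p" if "p \<in> P" for p
        using that near_sym[of \<Phi> r z p] by auto
      then have "sep (insert z P)"
        using P(2) by (simp add: sep_def)
      then have "z \<in> P"
        using maxP[of "insert z P"] z(1) P(1) by blast
      then show False
        using no near_refl[OF r, of \<Phi> z] by simp
    qed
    then obtain p where p: "p \<in> P" "near \<Phi> r p z"
      by (elim bexE)
    then show ?thesis
      using near_trans[OF p(2) z(2)] by (intro bexI[OF _ p(1)]) simp
  qed
  obtain ch S where ch: "\<And>p. p \<in> P \<Longrightarrow> ch p \<in> \<A>" "\<And>p. p \<in> P \<Longrightarrow> closedin M (S p)"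
    "\<And>p. p \<in> P \<Longrightarrow> S p \<subseteq> chart_dom (ch p) \<inter> U"
    "\<And>p q. p \<in> P \<Longrightarrow> q \<in> topspace M \<Longrightarrow> near \<Phi> r4 p q \<Longrightarrow> q \<in> S p"
  proof -
    have "\<exists>c S. c \<in> \<A> \<and> closedin M S \<and> S \<subseteq> chart_dom c \<inter> U \<and> (\<forall>q\<in>topspace M. near \<Phi> r4 p q \<longrightarrow> q \<in> S)"
      if "p \<in> P" for p
      using small4[of p] that PA by blast
    then show thesis
      using that by metis
  qed
  \<comment> \<open>The sup-distance itself is not smooth. A product of flat functions of squared
    differences is, and it is nonzero exactly where every difference is below 2r.\<close>
  define \<psi> where "\<psi> p q = (\<Prod>f\<in>\<Phi>. flat_exp ((2 * r)\<^sup>2 - (f p - f q) * (f p - f q)))" for p q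
  have \<psi>_nz: "\<psi> p q \<noteq> 0 \<longleftrightarrow> near \<Phi> (2 * r) p q" for p q
  proof -
    have "flat_exp ((2 * r)\<^sup>2 - (f p - f q) * (f p - f q)) \<noteq> 0 \<longleftrightarrow> \<bar>f p - f q\<bar> < 2 * r" for f :: "'a \<Rightarrow> real"
    proof -
      have pos: "flat_exp x \<noteq> 0 \<longleftrightarrow> x > 0" for x
        using flat_exp_pos_iff[of x] flat_exp_nonneg[of x] by linarith
      have "(f p - f q)\<^sup>2 < (2 * r)\<^sup>2 \<longleftrightarrow> \<bar>f p - f q\<bar> < \<bar>2 * r\<bar>"
        using abs_le_square_iff[of "2 * r" "f p - f q"] by linarith
      then have "(f p - f q) * (f p - f q) < (2 * r)\<^sup>2 \<longleftrightarrow> \<bar>f p - f q\<bar> < 2 * r"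
        using r by (simp only: power2_eq_square abs_of_pos mult_pos_pos zero_less_numeral)
      then show ?thesis
        using pos by simp
    qed
    then show ?thesis
      using \<Phi>(1) by (simp add: \<psi>_def near_def)
  qed
  have \<psi>_smooth: "smooth_function \<A> (\<psi> p)" for p
    unfolding smooth_function_iff \<psi>_def
    by (intro ballI smooth_in_prod smooth_in_compose_real[OF _ _ _ smooth_on_flat_exp] smooth_in_diff
        smooth_in_mult smooth_in_const smooth_functionD \<Phi>(2)) auto
  have \<psi>_supp: "\<psi> p q = 0" if "p \<in> P" "q \<in> topspace M - S p" for p q
  proof (rule ccontr)
    assume "\<psi> p q \<noteq> 0"
    then have "near \<Phi> r4 p q"
      using \<psi>_nz r near_mono[of \<Phi> "2 * r" p q r4] by (simp add: r4_eq)
    then show False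
      using ch(4)[OF that(1), of q] that(2) by simp
  qed
  \<comment> \<open>Half of r / 3^(card B + 1): if all functions in \<open>J\<close> differed by
    less than \<delta> at two centres, all of \<Phi> would differ by at most r/2, against
    separation. As 4r = 8 * 3^(card B + 1) * \<delta>, each coordinate meets 16 * 3^(card B + 1)
    cells.\<close>
  define \<delta> where "\<delta> = r / 3 ^ Suc (card B) / 2"
  have \<delta>: "\<delta> > 0"
    using r by (simp add: \<delta>_def)
  have deg: "card {q \<in> P. near \<Phi> r4 p q} \<le> (16 * 3 ^ Suc (card B)) ^ card B" if p: "p \<in> P" for p
  proof -
    obtain J where J: "J \<subseteq> \<Phi>" "card J \<le> card B" and
      ctrl: "\<And>q q' e. q \<in> topspace M \<Longrightarrow> q' \<in> topspace M \<Longrightarrow> near \<Phi> r4 p q \<Longrightarrow> near \<Phi> r4 p q' \<Longrightarrow> e \<ge> 0 \<Longrightarrow>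
        (\<forall>f\<in>J. \<bar>f q - f q'\<bar> \<le> e) \<Longrightarrow> (\<forall>f\<in>\<Phi>. \<bar>f q - f q'\<bar> \<le> 3 ^ Suc (card B) * e)"
      using ctrl4[OF subsetD[OF PA p], unfolded few_control_def] by (elim exE conjE) simp
    have "finite {q \<in> P. near \<Phi> r4 p q} \<and>
        card {q \<in> P. near \<Phi> r4 p q} \<le> (2 * (8 * 3 ^ Suc (card B))) ^ card J"
    proof (rule card_separated_le[where F = "\<lambda>f. f" and c = "\<lambda>f. f p", OF _ \<delta>])
      show "finite J"
        using J(1) \<Phi>(1) finite_subset by blast
      show "\<bar>j q - j p\<bar> < real (8 * 3 ^ Suc (card B)) * \<delta>" if "q \<in> {q \<in> P. near \<Phi> r4 p q}" "j \<in> J" for q j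
        using that J(1) by (auto simp: near_def r4_eq \<delta>_def abs_minus_commute)
      fix q q'
      assume q: "q \<in> {q \<in> P. near \<Phi> r4 p q}" "q' \<in> {q \<in> P. near \<Phi> r4 p q}" "q \<noteq> q'"
      show "\<exists>j\<in>J. \<delta> \<le> \<bar>j q - j q'\<bar>"
      proof (rule ccontr)
        assume "\<not> (\<exists>j\<in>J. \<delta> \<le> \<bar>j q - j q'\<bar>)"
        then have "\<forall>j\<in>J. \<bar>j q - j q'\<bar> \<le> \<delta>"
          by auto
        then have "\<forall>f\<in>\<Phi>. \<bar>f q - f q'\<bar> \<le> 3 ^ Suc (card B) * \<delta>"
          using q PA AM \<delta> by (intro ctrl) auto
        moreover have "3 ^ Suc (card B) * \<delta> < r"
          using r by (simp add: \<delta>_def)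
        ultimately have "near \<Phi> r q q'"
          unfolding near_def by (meson le_less_trans)
        then show False
          using q P(2) by (auto simp: sep_def)
      qed
    qed
    moreover have "(2 * (8 * k)) ^ card J \<le> (16 * k) ^ card B" if "k \<ge> 1" for k :: nat
      using power_increasing[OF J(2), of "16 * k"] that by (simp add: mult.assoc[symmetric])
    ultimately show ?thesis
      by (meson le_trans one_le_numeral one_le_power)
  qed
  have "\<exists>col. (\<forall>p\<in>P. col p < Suc ((16 * 3 ^ Suc (card B)) ^ card B)) \<and>
    (\<forall>p\<in>P. \<forall>q\<in>P. p \<noteq> q \<and> near \<Phi> r4 p q \<longrightarrow> col p \<noteq> col q)"
  proof (rule greedy_colouring[OF finP])
    show "near \<Phi> r4 q p" if "near \<Phi> r4 p q" for p q
      using that by (rule near_sym)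
    show "card {q \<in> P. near \<Phi> r4 p q} < Suc ((16 * 3 ^ Suc (card B)) ^ card B)" if "p \<in> P" for p
      using deg[OF that] by (rule le_imp_less_Suc)
  qed
  then obtain col where col: "\<forall>p\<in>P. col p < Suc ((16 * 3 ^ Suc (card B)) ^ card B)"
    "\<forall>p\<in>P. \<forall>q\<in>P. p \<noteq> q \<and> near \<Phi> r4 p q \<longrightarrow> col p \<noteq> col q"
    by (elim exE conjE)
  have "\<psi> p q = 0 \<or> \<psi> p' q = 0" if "p \<in> P" "p' \<in> P" "p \<noteq> p'" "col p = col p'" for p p' q
  proof (rule ccontr)
    assume "\<not> (\<psi> p q = 0 \<or> \<psi> p' q = 0)"
    then have "near \<Phi> (2 * r) p q" "near \<Phi> (2 * r) q p'"
      using \<psi>_nz near_sym by auto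
    then have "near \<Phi> r4 p p'"
      using near_trans[of \<Phi> "2 * r" p q "2 * r" p'] by (simp add: r4_eq)
    then show False
      using col(2) that by blast
  qed
  then have "proper_colouring P \<psi> col (Suc ((16 * 3 ^ Suc (card B)) ^ card B))"
    using col(1) unfolding proper_colouring_def by blast
  moreover have "bump_family U P \<psi> ch S"
    unfolding bump_family_def using ch \<psi>_smooth \<psi>_supp by blast
  moreover have "\<forall>q\<in>A. \<exists>p\<in>P. \<psi> p q \<noteq> 0"
    using cover \<psi>_nz by blast
  ultimately show ?thesis
    using finP by blast
qed

end

section \<open>Locally finite coloured bump functions\<close>

context framed_manifold
begin

lemma compact_neighbourhood:
  assumes "p \<in> topspace M"
  shows "\<exists>W C. openin M W \<and> p \<in> W \<and> W \<subseteq> C \<and> compactin M C"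
proof -
  obtain c where c: "c \<in> \<A>" "p \<in> chart_dom c"
    using chart_at[OF assms] .
  let ?x = "chart_map c p"
  obtain \<rho> where \<rho>: "\<rho> > 0" "cball ?x \<rho> \<subseteq> chart_img c"
    using open_chart_img[OF c(1)] chart_map_in_img[OF c(2)] open_contains_cball by blast
  let ?W = "{q \<in> chart_dom c. chart_map c q \<in> ball ?x \<rho>}" and ?C = "chart_inv c ` cball ?x \<rho>"
  have "?W \<subseteq> ?C"
  proof
    fix q
    assume "q \<in> ?W"
    then have "q = chart_inv c (chart_map c q)" "chart_map c q \<in> cball ?x \<rho>"
      using chart_inv_chart_map[OF c(1)] by auto
    then show "q \<in> ?C"
      by (rule image_eqI)
  qed
  moreover have "openin M ?W"
    by (rule openin_chart_preimage[OF c(1) open_ball])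
  moreover have "compactin M ?C"
    using c(1) compact_cball_frame[OF frame] \<rho>(2) by (rule compactin_chart_inv_image)
  moreover have "p \<in> ?W"
    using c \<rho>(1) by simp
  ultimately show ?thesis
    by (intro exI conjI)
qed

text \<open>Second countability enters through the Lindelof property: countably many open sets with
  compact hulls cover M. Their finite unions are thinned to a sequence in which each hull lies in
  the next open set.\<close>

lemma compact_exhaustion:
  assumes "second_countable M"
  shows "\<exists>G K. (\<forall>j::nat. openin M (G j) \<and> compactin M (K j) \<and> G j \<subseteq> K j \<and> K j \<subseteq> G (Suc j)) \<and>
    (\<Union>j. G j) = topspace M"
proof -
  define \<U> where "\<U> = {W. openin M W \<and> (\<exists>C. W \<subseteq> C \<and> compactin M C)}"
  have "\<Union>\<U> = topspace M"
  proof
    show "\<Union>\<U> \<subseteq> topspace M"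
      using openin_subset by (auto simp: \<U>_def)
    show "topspace M \<subseteq> \<Union>\<U>"
    proof
      fix p
      assume "p \<in> topspace M"
      then show "p \<in> \<Union>\<U>"
        using compact_neighbourhood[of p] unfolding \<U>_def by blast
    qed
  qed
  then obtain \<V> where \<V>: "countable \<V>" "\<V> \<subseteq> \<U>" "\<Union>\<V> = topspace M"
    using second_countable_imp_Lindelof_space[OF assms, unfolded Lindelof_space_def, rule_format, of \<U>]
    by (auto simp: \<U>_def)
  \<comment> \<open>The inserted empty set allows an enumeration even if M, and with it the
    countable cover, is empty.\<close>
  define w where "w = from_nat_into (insert {} \<V>)"
  have range_w: "range w = insert {} \<V>"
    unfolding w_def using \<V>(1) by (intro range_from_nat_into) auto
  have "{} \<in> \<U>"
    by (auto simp: \<U>_def)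
  then have "w n \<in> \<U>" for n
    using range_w \<V>(2) by (metis insertE rangeI subsetD)
  then have "\<exists>C. openin M (w n) \<and> w n \<subseteq> C \<and> compactin M C" for n
    unfolding \<U>_def by blast
  then obtain C where w: "\<And>n. openin M (w n)" "\<And>n. w n \<subseteq> C n" "\<And>n. compactin M (C n)"
    by metis
  define H where "H n = (\<Union>i<n. w i)" for n :: nat
  define L where "L n = (\<Union>i<n. C i)" for n :: nat
  have openH: "openin M (H n)" for n
    unfolding H_def using w(1) by (intro openin_Union) auto
  have compactL: "compactin M (L n)" for n
    unfolding L_def using w(3) by (intro compactin_Union) auto
  have HL: "H n \<subseteq> L n" for n
    unfolding H_def L_def using w(2) by (intro UN_mono) auto
  have monoH: "H m \<subseteq> H n" if "m \<le> n" for m n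
    unfolding H_def using that by (intro UN_mono) auto
  have "(\<Union>n. w n) = topspace M"
    using range_w \<V>(3) by simp
  moreover have "(\<Union>n. w n) = (\<Union>n. H n)"
    unfolding H_def by (rule set_eqI) auto
  ultimately have HM: "(\<Union>n. H n) = topspace M"
    by simp
  have "\<exists>m. L n \<subseteq> H m" for n
  proof -
    have "L n \<subseteq> (\<Union>n. H n)"
      using compactin_subset_topspace[OF compactL] HM by simp
    then obtain \<F> where \<F>: "finite \<F>" "\<F> \<subseteq> range H" "L n \<subseteq> \<Union>\<F>"
      using compactinD[OF compactL, of "range H" n] openH by auto
    obtain D where D: "finite D" "\<F> = H ` D"
      using finite_subset_image[OF \<F>(1,2)] by blast
    have "\<Union>\<F> \<subseteq> H (Max (insert 0 D))"
      unfolding D(2) using D(1) by (intro UN_least monoH Max_ge) auto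
    then show ?thesis
      using \<F>(3) by blast
  qed
  then obtain \<phi> where \<phi>: "\<And>n. L n \<subseteq> H (\<phi> n)"
    by metis
  \<comment> \<open>The term \<open>\<phi> k\<close> brings the hull into the next open set, and
    \<open>Suc k\<close> makes the indices grow, so that the subsequence still exhausts M.\<close>
  define m where "m = rec_nat 0 (\<lambda>_ k. max (Suc k) (\<phi> k))"
  have m_Suc: "m (Suc j) = max (Suc (m j)) (\<phi> (m j))" for j
    by (simp add: m_def)
  have m_ge: "j \<le> m j" for j
    by (induction j) (auto simp: m_Suc le_max_iff_disj)
  have "L (m j) \<subseteq> H (m (Suc j))" for j
    using \<phi>[of "m j"] monoH[of "\<phi> (m j)" "m (Suc j)"] by (auto simp: m_Suc)
  moreover have "(\<Union>j. H (m j)) = topspace M"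
  proof
    show "(\<Union>j. H (m j)) \<subseteq> topspace M"
      using HM by blast
    show "topspace M \<subseteq> (\<Union>j. H (m j))"
      unfolding HM[symmetric] by (intro UN_mono monoH m_ge) auto
  qed
  ultimately show ?thesis
    using openH compactL HL by (intro exI[of _ "\<lambda>j. H (m j)"] exI[of _ "\<lambda>j. L (m j)"]) simp
qed

definition locally_finite_bumps :: "'i set \<Rightarrow> ('i \<Rightarrow> 'a \<Rightarrow> real) \<Rightarrow> bool" where
  "locally_finite_bumps I \<psi> \<longleftrightarrow>
     (\<forall>p\<in>topspace M. \<exists>W. openin M W \<and> p \<in> W \<and> finite {i\<in>I. \<exists>q\<in>W. \<psi> i q \<noteq> 0})"

text \<open>
  The bands \<open>K j - G (j - 1)\<close> of the exhaustion are treated separately; bands whose indices differ by at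
  least three do not interact, so three copies of the colours suffice.
\<close>

lemma coloured_bumps:
  assumes "second_countable M"
  shows "\<exists>I \<psi> ch S col N. bump_family (topspace M) (I::(nat \<times> 'a) set) \<psi> ch S \<and>
    proper_colouring I \<psi> col N \<and> 0 < N \<and> locally_finite_bumps I \<psi> \<and>
    (\<forall>q\<in>topspace M. \<exists>i\<in>I. \<psi> i q \<noteq> 0)"
proof -
  obtain G K where GK: "\<And>j::nat. openin M (G j)" "\<And>j. compactin M (K j)" "\<And>j. G j \<subseteq> K j"
    "\<And>j. K j \<subseteq> G (Suc j)" and GM: "(\<Union>j. G j) = topspace M"
    using compact_exhaustion[OF assms] by metis
  have closedK: "closedin M (K j)" for j
    using compactin_imp_closedin[OF Hausdorff GK(2)] .
  define A where "A j = K j - (\<Union>i<j. G i)" for j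
  \<comment> \<open>\<open>U j\<close> is an open neighbourhood of the band \<open>A j\<close> that
    lies in \<open>G (Suc j)\<close> and misses every \<open>K i\<close> with i + 2 \<le> j. Hence
    \<open>U i\<close> lies in \<open>K (Suc i)\<close>, which \<open>U j\<close> misses once i + 3
    \<le> j. The unions avoid natural subtraction at small j.\<close>
  define U where "U j = G (Suc j) - (\<Union>i\<in>{i. i + 2 \<le> j}. K i)" for j
  have compactA: "compactin M (A j)" for j
  proof (rule closed_compactin[OF GK(2)])
    show "closedin M (A j)"
      unfolding A_def using closedK GK(1) by (intro closedin_diff openin_Union) auto
  qed (auto simp: A_def)
  have openU: "openin M (U j)" for j
  proof -
    have "{i. i + 2 \<le> j} \<subseteq> {..j}"
      by auto
    then have "finite {i. i + 2 \<le> j}"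
      using finite_subset by blast
    then show ?thesis
      unfolding U_def using closedK GK(1) by (intro openin_diff closedin_Union) auto
  qed
  have AU: "A j \<subseteq> U j" for j
  proof
    fix p
    assume p: "p \<in> A j"
    have "p \<notin> K i" if "i + 2 \<le> j" for i
    proof
      assume "p \<in> K i"
      then have "p \<in> G (Suc i)"
        using GK(4) by blast
      moreover have "Suc i < j"
        using that by simp
      ultimately show False
        using p by (auto simp: A_def)
    qed
    moreover have "p \<in> G (Suc j)"
      using p GK(4) by (auto simp: A_def)
    ultimately show "p \<in> U j"
      by (auto simp: U_def)
  qed
  have far: "U i \<inter> U j = {}" if "i + 3 \<le> j" for i j
  proof -
    have "U i \<subseteq> K (Suc i)"
      using GK(3) by (auto simp: U_def)
    moreover have "U j \<inter> K (Suc i) = {}"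
      using that by (auto simp: U_def)
    ultimately show ?thesis
      by blast
  qed
  have cover: "\<exists>j. p \<in> A j" if "p \<in> topspace M" for p
  proof -
    have ex: "\<exists>j. p \<in> K j"
      using that GM GK(3) by blast
    let ?j = "LEAST j. p \<in> K j"
    have "p \<in> K ?j"
      using ex by (rule LeastI_ex)
    moreover have "p \<notin> G i" if "i < ?j" for i
      using not_less_Least[OF that] GK(3) by blast
    ultimately show ?thesis
      unfolding A_def by blast
  qed
  \<comment> \<open>The same number for all bands: this is what independence of the compact set
    buys.\<close>
  define N where "N = Suc ((16 * 3 ^ Suc (card B)) ^ card B)"
  have N: "N > 0"
    by (simp add: N_def)
  have "\<forall>j. \<exists>P \<psi> ch S col. finite P \<and> bump_family (U j) P \<psi> ch S \<and>
      proper_colouring P \<psi> col N \<and> (\<forall>q\<in>A j. \<exists>p\<in>P. \<psi> (p::'a) q \<noteq> 0)"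
    using coloured_bumps_on_compact[OF compactA openU AU] unfolding N_def by blast
  then obtain P :: "nat \<Rightarrow> 'a set" and \<psi> ch S col where P: "\<And>j. finite (P j)" and fam: "\<And>j. bump_family (U j) (P j) (\<psi> j) (ch j) (S j)"
    and col: "\<And>j. proper_colouring (P j) (\<psi> j) (col j) N"
    and cov: "\<And>j. \<forall>q\<in>A j. \<exists>p\<in>P j. \<psi> j p q \<noteq> 0"
    by metis
  have supp: "q \<in> U j" if "p \<in> P j" "q \<in> topspace M" "\<psi> j p q \<noteq> 0" for j p q
    using fam[of j] that unfolding bump_family_def by blast
  define I where "I = (SIGMA j:UNIV. P j)"
  define \<psi>' where "\<psi>' = (\<lambda>(j, p). \<psi> j p)"
  \<comment> \<open>The pair of residue and local colour as one number; division by \<open>N\<close>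
    recovers the residue because the local colour is below \<open>N\<close>.\<close>
  define col' where "col' = (\<lambda>(j, p). (j mod 3) * N + col j p)"
  have "bump_family (topspace M) I \<psi>' (\<lambda>(j, p). ch j p) (\<lambda>(j, p). S j p)"
  proof -
    have "U j \<subseteq> topspace M" for j
      using openin_subset[OF openU] .
    then show ?thesis
      using fam unfolding bump_family_def I_def \<psi>'_def by fastforce
  qed
  moreover have "proper_colouring I \<psi>' col' (3 * N)"
    unfolding proper_colouring_def
  proof (intro conjI ballI impI)
    fix i
    assume "i \<in> I"
    then obtain j p where i: "i = (j, p)" "p \<in> P j"
      by (auto simp: I_def)
    have "j mod 3 * N \<le> 2 * N"
      by (intro mult_right_mono) auto
    moreover have "col j p < N"
      using col[of j] i(2) by (simp add: proper_colouring_def)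
    ultimately have "j mod 3 * N + col j p < 3 * N"
      by linarith
    then show "col' i < 3 * N"
      by (simp add: col'_def i(1))
  next
    fix i i' q
    assume ii': "i \<in> I" "i' \<in> I" "i \<noteq> i' \<and> col' i = col' i'" and q: "q \<in> topspace M"
    obtain j p j' p' where i: "i = (j, p)" "p \<in> P j" and i': "i' = (j', p')" "p' \<in> P j'"
      using ii'(1,2) by (auto simp: I_def)
    have lt: "col j p < N" "col j' p' < N"
      using col[of j] col[of j'] i(2) i'(2) by (simp_all add: proper_colouring_def)
    have eq: "j mod 3 * N + col j p = j' mod 3 * N + col j' p'"
      using ii'(3) by (simp add: col'_def i(1) i'(1))
    have "(j mod 3 * N + col j p) div N = j mod 3" "(j' mod 3 * N + col j' p') div N = j' mod 3"
      using lt N by simp_all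
    then have mod: "j mod 3 = j' mod 3"
      using eq by simp
    then have coleq: "col j p = col j' p'"
      using eq by simp
    show "\<psi>' i q = 0 \<or> \<psi>' i' q = 0"
    proof (cases "j = j'")
      case True
      then have "p \<noteq> p'"
        using ii'(3) i i' by simp
      then show ?thesis
        using col[of j] i i' True coleq q unfolding proper_colouring_def \<psi>'_def by auto
    next
      case False
      then have "j + 3 \<le> j' \<or> j' + 3 \<le> j"
        using mod by presburger
      then have "U j \<inter> U j' = {}"
        using far by blast
      then show ?thesis
        using supp[OF i(2) q] supp[OF i'(2) q] by (auto simp: \<psi>'_def i(1) i'(1))
    qed
  qed
  moreover have "locally_finite_bumps I \<psi>'"
    unfolding locally_finite_bumps_def
  proof
    fix p
    assume "p \<in> topspace M"
    then obtain k where k: "p \<in> G k"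
      using GM by blast
    \<comment> \<open>\<open>G k\<close> lies in \<open>K k\<close>, which \<open>U j\<close> misses
      as soon as k + 2 \<le> j; only finitely many bands remain, each with finitely many
      bumps.\<close>
    have "{i\<in>I. \<exists>q\<in>G k. \<psi>' i q \<noteq> 0} \<subseteq> (SIGMA j:{..<k + 2}. P j)"
    proof
      fix i
      assume "i \<in> {i\<in>I. \<exists>q\<in>G k. \<psi>' i q \<noteq> 0}"
      then obtain j p q where i: "i = (j, p)" "p \<in> P j" "q \<in> G k" "\<psi> j p q \<noteq> 0"
        by (auto simp: I_def \<psi>'_def)
      have "q \<in> U j"
        using supp[OF i(2) _ i(4)] i(3) GM by blast
      moreover have "q \<in> K k"
        using i(3) GK(3) by blast
      ultimately have "\<not> k + 2 \<le> j"
        by (auto simp: U_def)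
      then show "i \<in> (SIGMA j:{..<k + 2}. P j)"
        using i by auto
    qed
    moreover have "finite (SIGMA j:{..<k + 2}. P j)"
      using P by auto
    ultimately have "finite {i\<in>I. \<exists>q\<in>G k. \<psi>' i q \<noteq> 0}"
      using finite_subset by blast
    with k GK(1) show "\<exists>W. openin M W \<and> p \<in> W \<and> finite {i\<in>I. \<exists>q\<in>W. \<psi>' i q \<noteq> 0}"
      by blast
  qed
  moreover have "\<exists>i\<in>I. \<psi>' i q \<noteq> 0" if q: "q \<in> topspace M" for q
  proof -
    obtain j p where "p \<in> P j" "\<psi> j p q \<noteq> 0"
      using cover[OF q] cov by blast
    then show ?thesis
      by (intro bexI[of _ "(j, p)"]) (auto simp: I_def \<psi>'_def)
  qed
  moreover have "0 < 3 * N"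
    using N by simp
  ultimately show ?thesis
    by blast
qed

end

section \<open>The generating vector fields\<close>

lemma vector_fields_finitely_generatedI:
  assumes "finite T" "T \<noteq> {}" "\<And>t. t \<in> T \<Longrightarrow> smooth_vector_field M \<A> (X t)"
    and gen: "\<And>Y. smooth_vector_field M \<A> Y \<Longrightarrow> \<exists>f. (\<forall>t\<in>T. smooth_function \<A> (f t)) \<and>
      (\<forall>p\<in>topspace M. \<forall>c. Y p c = (\<Sum>t\<in>T. f t p *\<^sub>R X t p c))"
  shows "vector_fields_finitely_generated M \<A>"
proof -
  obtain h where h: "bij_betw h {1..card T} T"
    using ex_bij_betw_nat_finite_1[OF assms(1)] by blast
  have hT: "h i \<in> T" if "i \<in> {1..card T}" for i
    using bij_betwE[OF h] that by blast
  have "\<exists>f. (\<forall>i\<in>{1..card T}. smooth_function \<A> (f i)) \<and>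
      (\<forall>p\<in>topspace M. Y p = (\<lambda>c. \<Sum>i=1..card T. f i p *\<^sub>R X (h i) p c))"
    if "smooth_vector_field M \<A> Y" for Y
  proof -
    obtain f where f: "\<forall>t\<in>T. smooth_function \<A> (f t)"
      "\<forall>p\<in>topspace M. \<forall>c. Y p c = (\<Sum>t\<in>T. f t p *\<^sub>R X t p c)"
      using gen[OF \<open>smooth_vector_field M \<A> Y\<close>] by blast
    have "Y p = (\<lambda>c. \<Sum>i=1..card T. f (h i) p *\<^sub>R X (h i) p c)" if "p \<in> topspace M" for p
      using f(2) that sum.reindex_bij_betw[OF h, of "\<lambda>t. f t p *\<^sub>R X t p c" for c] by auto
    then show ?thesis
      using f(1) hT by (intro exI[of _ "\<lambda>i. f (h i)"]) auto
  qed
  moreover have "card T > 0"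
    using assms(1,2) by (simp add: card_gt_0_iff)
  ultimately show ?thesis
    unfolding vector_fields_finitely_generated_def using assms(3) hT
    by (intro exI[of _ "card T"] exI[of _ "\<lambda>i. X (h i)"]) auto
qed

context framed_manifold
begin

lemma locally_finite_at:
  assumes "locally_finite_bumps I \<psi>" "p \<in> topspace M"
  shows "finite {i\<in>I. \<psi> i p \<noteq> 0}"
proof -
  obtain W where "p \<in> W" "finite {i\<in>I. \<exists>q\<in>W. \<psi> i q \<noteq> 0}"
    using assms unfolding locally_finite_bumps_def by blast
  then show ?thesis
    by (elim rev_finite_subset) auto
qed

text \<open>The index set varies with q to stay finite, since a sum over an infinite set is 0 by
  convention. Near each point it may be replaced by a fixed finite set, the added terms being 0.
  \<open>Q\<close> selects a colour.\<close>

lemma smooth_in_locally_finite_sum: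
  fixes F :: "'i \<Rightarrow> 'a \<Rightarrow> 'b::real_normed_vector"
  assumes c: "c \<in> \<A>" and fin: "locally_finite_bumps I \<psi>"
    and F: "\<And>i. i \<in> I \<Longrightarrow> smooth_in c (topspace M) (F i)"
    and 0: "\<And>i q. i \<in> I \<Longrightarrow> q \<in> topspace M \<Longrightarrow> \<psi> i q = 0 \<Longrightarrow> F i q = 0"
  shows "smooth_in c (topspace M) (\<lambda>q. \<Sum>i\<in>{i\<in>I. Q i \<and> \<psi> i q \<noteq> 0}. F i q)"
proof (rule smooth_in_local[OF c])
  fix p
  assume "p \<in> topspace M"
  then obtain W where W: "openin M W" "p \<in> W" "finite {i\<in>I. \<exists>q\<in>W. \<psi> i q \<noteq> 0}"
    using fin unfolding locally_finite_bumps_def by blast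
  let ?J = "{i\<in>I. Q i \<and> (\<exists>q\<in>W. \<psi> i q \<noteq> 0)}"
  have WM: "W \<subseteq> topspace M"
    using openin_subset[OF W(1)] .
  have finJ: "finite ?J"
    by (rule finite_subset[OF _ W(3)]) auto
  have "smooth_in c W (\<lambda>q. \<Sum>i\<in>?J. F i q)"
    using WM by (intro smooth_in_sum[OF c W(1)] smooth_in_subset[OF F]) auto
  moreover have "(\<Sum>i\<in>{i\<in>I. Q i \<and> \<psi> i q \<noteq> 0}. F i q) = (\<Sum>i\<in>?J. F i q)" if "q \<in> W" for q
    using finJ that 0 WM by (intro sum.mono_neutral_left) auto
  ultimately have "smooth_in c W (\<lambda>q. \<Sum>i\<in>{i\<in>I. Q i \<and> \<psi> i q \<noteq> 0}. F i q)"
    by (subst smooth_in_cong[OF c W(1)])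
  with W(1,2) show "\<exists>W. openin M W \<and> p \<in> W \<and> smooth_in c W (\<lambda>q. \<Sum>i\<in>{i\<in>I. Q i \<and> \<psi> i q \<noteq> 0}. F i q)"
    by blast
qed

text \<open>Generators are indexed by a colour and a frame vector; \<open>B \<noteq> {}\<close>
  together with \<open>0 < N\<close> makes their number positive.\<close>

lemma finitely_generated_if_frame_nonempty:
  assumes "second_countable M" and "B \<noteq> {}"
  shows "vector_fields_finitely_generated M \<A>"
proof -
  obtain I :: "(nat \<times> 'a) set" and \<psi> ch S col N where
    fam: "bump_family (topspace M) I \<psi> ch S" and col: "proper_colouring I \<psi> col N" and N: "0 < N"
    and fin: "locally_finite_bumps I \<psi>" and cover: "\<forall>q\<in>topspace M. \<exists>i\<in>I. \<psi> i q \<noteq> 0"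
    using coloured_bumps[OF assms(1)] by (elim exE conjE)
  have \<psi>: "smooth_function \<A> (\<psi> i)" and ch: "ch i \<in> \<A>" and S: "closedin M (S i)" "S i \<subseteq> chart_dom (ch i)"
    and supp: "\<And>q. q \<in> topspace M - S i \<Longrightarrow> \<psi> i q = 0" if "i \<in> I" for i
    using fam that unfolding bump_family_def by blast+
  have in_dom: "q \<in> chart_dom (ch i)" if "i \<in> I" "q \<in> topspace M" "\<psi> i q \<noteq> 0" for i q
    using supp[OF that(1), of q] S(2)[OF that(1)] that by blast
  define act where "act t q = {i\<in>I. col i = t \<and> \<psi> i q \<noteq> 0}" for t q
  define X where "X = (\<lambda>(t, b) q c. \<Sum>i\<in>act t q. \<psi> i q *\<^sub>R coord_field (ch i) b q c)"
  \<comment> \<open>Squares, because each bump occurs once in a coefficient and once in a field. The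
    vacuous \<open>True\<close> is the selection \<open>Q\<close> that admits every colour.\<close>
  define \<sigma> where "\<sigma> q = (\<Sum>i\<in>{i\<in>I. True \<and> \<psi> i q \<noteq> 0}. \<psi> i q * \<psi> i q)" for q
  have \<sigma>_pos: "\<sigma> q > 0" if q: "q \<in> topspace M" for q
  proof -
    have "{i\<in>I. True \<and> \<psi> i q \<noteq> 0} \<noteq> {}"
      using cover q by blast
    moreover have "\<psi> i q * \<psi> i q > 0" if "\<psi> i q \<noteq> 0" for i
      using that by (metis not_real_square_gt_zero)
    ultimately show ?thesis
      unfolding \<sigma>_def using locally_finite_at[OF fin q] by (intro sum_pos) simp_all
  qed
  have \<sigma>_smooth: "smooth_in c (topspace M) \<sigma>" if c: "c \<in> \<A>" for c
    unfolding \<sigma>_def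
    by (intro smooth_in_locally_finite_sum[OF c fin] smooth_in_mult[OF c openin_topspace]
        smooth_functionD[OF \<psi> c order_refl]) auto
  have "smooth_vector_field M \<A> (X (t, b))" for t b
    unfolding smooth_vector_field_iff
  proof (intro conjI ballI)
    fix q
    assume q: "q \<in> topspace M"
    have "coord_field (ch i) b q \<in> tangent_space \<A> q" if "i \<in> act t q" for i
      using that in_dom[OF _ q] by (intro coord_field_in_tangent_space ch) (auto simp: act_def)
    then show "X (t, b) q \<in> tangent_space \<A> q"
      unfolding X_def prod.case by (rule tangent_space_sum_scaleR)
  next
    fix c
    assume c: "c \<in> \<A>"
    have "smooth_in c (topspace M) (\<lambda>q. \<psi> i q *\<^sub>R coord_field (ch i) b q c)" if i: "i \<in> I" for i
    proof (rule smooth_in_extend_by_0[OF c ch[OF i] S[OF i]])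
      have dom: "openin M (chart_dom (ch i))"
        by (rule openin_chart_dom[OF ch[OF i]])
      show "smooth_in c (chart_dom (ch i)) (\<lambda>q. \<psi> i q *\<^sub>R coord_field (ch i) b q c)"
        by (intro smooth_in_scaleR[OF c dom] smooth_functionD[OF \<psi>[OF i] c] smooth_in_coord_field[OF c ch[OF i]]
            chart_dom_subset ch i)
    qed (simp add: supp[OF i])
    then show "smooth_in c (topspace M) (\<lambda>p. X (t, b) p c)"
      unfolding X_def prod.case act_def by (intro smooth_in_locally_finite_sum[OF c fin]) auto
  qed
  moreover have "\<exists>f. (\<forall>t\<in>{..<N} \<times> B. smooth_function \<A> (f t)) \<and>
      (\<forall>q\<in>topspace M. \<forall>c. Y q c = (\<Sum>t\<in>{..<N} \<times> B. f t q *\<^sub>R X t q c))"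
    if Y: "smooth_vector_field M \<A> Y" for Y
  proof -
    \<comment> \<open>Each bump cuts off the coordinates of \<open>Y\<close> in its own chart, so
      every numerator is smooth on all of M; dividing by \<sigma> normalises the squares.\<close>
    define f where "f = (\<lambda>(t, b) q. (\<Sum>i\<in>act t q. \<psi> i q * (Y q (ch i) \<bullet> b)) / \<sigma> q)"
    have "smooth_function \<A> (\<lambda>q. \<psi> i q * (Y q (ch i) \<bullet> b))" if i: "i \<in> I" for i b
    proof (rule smooth_function_extend_by_0[OF ch[OF i] S[OF i]])
      have dom: "openin M (chart_dom (ch i))"
        by (rule openin_chart_dom[OF ch[OF i]])
      have "smooth_in (ch i) (topspace M) (\<lambda>q. Y q (ch i))"
        using Y ch[OF i] unfolding smooth_vector_field_iff by blast
      then have "smooth_in (ch i) (chart_dom (ch i)) (\<lambda>q. Y q (ch i))"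
        by (rule smooth_in_subset) (use chart_dom_subset[OF ch[OF i]] in auto)
      then show "smooth_in (ch i) (chart_dom (ch i)) (\<lambda>q. \<psi> i q * (Y q (ch i) \<bullet> b))"
        by (intro smooth_in_mult[OF ch[OF i] dom] smooth_functionD[OF \<psi>[OF i] ch[OF i]]
            smooth_in_inner_left[OF ch[OF i] dom] chart_dom_subset ch i)
    qed (simp add: supp[OF i])
    then have num: "smooth_in c (topspace M) (\<lambda>q. \<Sum>i\<in>act t q. \<psi> i q * (Y q (ch i) \<bullet> b))"
      if "c \<in> \<A>" for c t b
      unfolding act_def using that
      by (intro smooth_in_locally_finite_sum[OF that fin]) (auto simp: smooth_function_iff)
    have "smooth_function \<A> (f (t, b))" for t b
      unfolding smooth_function_iff f_def prod.case
    proof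
      fix c
      assume c: "c \<in> \<A>"
      show "smooth_in c (topspace M) (\<lambda>q. (\<Sum>i\<in>act t q. \<psi> i q * (Y q (ch i) \<bullet> b)) / \<sigma> q)"
        using \<sigma>_pos by (intro smooth_in_divide[OF c openin_topspace num[OF c] \<sigma>_smooth[OF c]]) force
    qed
    moreover have "Y q c = (\<Sum>t\<in>{..<N} \<times> B. f t q *\<^sub>R X t q c)" if q: "q \<in> topspace M" for q c
    proof -
      have Yq: "Y q \<in> tangent_space \<A> q"
        using Y q unfolding smooth_vector_field_iff by blast
      let ?act = "{i\<in>I. \<psi> i q \<noteq> 0}"
      have finact: "finite ?act"
        by (rule locally_finite_at[OF fin q])
      have "(\<Sum>b\<in>B. f (t, b) q *\<^sub>R X (t, b) q c) = (\<Sum>i\<in>{i\<in>?act. col i = t}. ((\<psi> i q * \<psi> i q) / \<sigma> q) *\<^sub>R Y q c)" for t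
      proof -
        have act_eq: "act t q = {i\<in>?act. col i = t}"
          by (auto simp: act_def)
        \<comment> \<open>At a given point at most one bump of each colour is nonzero, so the
          product of the two sums over \<open>act t q\<close> has no mixed terms.\<close>
        have uniq: "i = j" if "i \<in> act t q" "j \<in> act t q" for i j
        proof (rule ccontr)
          assume "i \<noteq> j"
          then have "\<psi> i q = 0 \<or> \<psi> j q = 0"
            using conjunct2[OF col[unfolded proper_colouring_def], rule_format, of i j q] that q
            by (simp add: act_def)
          then show False
            using that by (simp add: act_def)
        qed
        show ?thesis
        proof (cases "act t q = {}")
          case True
          then show ?thesis
            unfolding act_eq[symmetric] f_def X_def by simp
        next
          case False
          then obtain i where "i \<in> act t q"
            by blast
          then have single: "act t q = {i}"
            using uniq by blast
          then have i: "i \<in> I" "\<psi> i q \<noteq> 0"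
            by (auto simp: act_def)
          have "(\<Sum>b\<in>B. f (t, b) q *\<^sub>R X (t, b) q c) =
              (\<Sum>b\<in>B. ((\<psi> i q * \<psi> i q) / \<sigma> q) *\<^sub>R ((Y q (ch i) \<bullet> b) *\<^sub>R coord_field (ch i) b q c))"
            unfolding f_def X_def prod.case single by (intro sum.cong) (simp_all add: mult_ac)
          also have "\<dots> = ((\<psi> i q * \<psi> i q) / \<sigma> q) *\<^sub>R Y q c"
            using coord_field_expansion[OF ch[OF i(1)] in_dom[OF i(1) q i(2)] Yq, of c]
            by (simp only: scaleR_sum_right)
          finally show ?thesis
            unfolding act_eq[symmetric] single by simp
        qed
      qed
      then have "(\<Sum>t\<in>{..<N} \<times> B. f t q *\<^sub>R X t q c) =
          (\<Sum>t<N. \<Sum>i\<in>{i\<in>?act. col i = t}. ((\<psi> i q * \<psi> i q) / \<sigma> q) *\<^sub>R Y q c)"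
        by (simp add: sum.cartesian_product' split_def)
      \<comment> \<open>Summing over colours recovers the sum over all active bumps, since every
        bump has exactly one colour below \<open>N\<close>.\<close>
      also have "\<dots> = (\<Sum>i\<in>?act. ((\<psi> i q * \<psi> i q) / \<sigma> q) *\<^sub>R Y q c)"
        using col finact by (intro sum.group) (auto simp: proper_colouring_def)
      also have "\<dots> = (\<sigma> q / \<sigma> q) *\<^sub>R Y q c"
        by (simp only: \<sigma>_def simp_thms sum_divide_distrib scaleR_sum_left)
      also have "\<dots> = Y q c"
        using \<sigma>_pos[OF q] by simp
      finally show ?thesis
        by simp
    qed
    ultimately show ?thesis
      by (intro exI[of _ f]) auto
  qed
  ultimately show ?thesis
    using N assms(2) frame
    by (intro vector_fields_finitely_generatedI[of "{..<N} \<times> B" M \<A> X]) (auto simp: is_frame_def)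
qed

end

theorem mainTheorem3:
  fixes M :: "'a topology" and \<A> :: "('a, 'e::real_inner) chart set"
  assumes "smooth_manifold M \<A>" and "second_countable M"
  shows "vector_fields_finitely_generated M \<A>"
proof -
  obtain B :: "'e set" where B: "is_frame B"
    using assms(1) finite_dimensional_imp_frame by (auto simp: smooth_manifold_def)
  \<comment> \<open>The added 0 contributes nothing to expansions. It may raise the cardinality of
    the frame by one, which only enlarges the number of colours.\<close>
  then have "is_frame (insert 0 B)"
    by (auto simp: is_frame_def sum.insert_if)
  then interpret framed_manifold M \<A> "insert 0 B"
    using assms(1) by unfold_locales
  show ?thesis
    using finitely_generated_if_frame_nonempty[OF assms(2)] by simp
qed

end
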